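(* Let $A$ be a set and $n\geq1$. Let $\mathscr C\subseteq\mathscr D$ be oligomorphic function clones on $A$, where $\mathscr D$ is a model-complete core without algebraicity and $\mathscr C$ is $n$-canonical with respect to $\mathscr G_{\mathscr D}$. Suppose that $\mathscr C^n/\mathscr G_{\mathscr D}$ is equationally trivial. Then there exists an $n$-ary naked set $(S,\sim)$ of $\mathscr C$ with $\mathscr G_{\mathscr D}$-invariant $\sim$-classes such that one of the following holds: (1) $\sim$ is approximated by a $\mathscr D$-invariant equivalence relation that is presmooth with respect to $\mathscr G_{\mathscr D}$; (2) every $\mathscr D$-invariant binary symmetric relation $R\subseteq(A^n)^2$ that contains a pair $(a,b)\in S^2$ with $a,b$ disjoint and $a\not\sim b$ contains a pair $(c,c')$ with $c,c'$ in the same $\mathscr G_{\mathscr D}$-orbit.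
   Context: A function clone on $A$ is a set of finitary operations on $A$ containing all projections and closed under composition; it acts componentwise on $A^n$, and a relation on $A^n$ (or $(A^n)^2$, viewed as a relation on $A$) is invariant if preserved by all functions of the clone. $\mathscr G_{\mathscr D}$ is the group of unary bijections in $\mathscr D$ whose inverse is in $\mathscr D$. $\mathscr D$ is oligomorphic if $\mathscr G_{\mathscr D}$ has finitely many orbits on $A^m$ for each $m$; without algebraicity if every stabilizer in $\mathscr G_{\mathscr D}$ of finitely many points has only infinite orbits apart from the fixed points; a model-complete core if its unary functions are exactly the closure of $\mathscr G_{\mathscr D}$ in the topology of pointwise convergence. $\mathscr C$ is $n$-canonical w.r.t. $\mathscr G$ if its functions preserve $\mathscr G$-orbit equivalence of $n$-tuples; then $\mathscr C^n/\mathscr G$ is the induced clone on the set of $\mathscr G$-orbits of $n$-tuples. A clone is equationally trivial if it has a clone homomorphism (arity-preserving, projection-preserving, composition-preserving map) to the clone of projections on $\{0,1\}$. An $n$-ary naked set of $\mathscr C$ is a pair $(S,\sim)$ with $S\subseteq A^n$ $\mathscr C$-invariant, $\sim$ a $\mathscr C$-invariant equivalence relation on $S$ with at least two classes, such that every function of $\mathscr C$ acts on $S/{\sim}$ as a projection. Tuples are disjoint if they share no entry. An approximation of $\sim$ is an equivalence relation $\eta$ on some $S'$ with $S\subseteq S'\subseteq A^n$ whose restriction to $S$ refines $\sim$; for a group $\mathscr G$ leaving $\eta$ and the $\sim$-classes invariant, $\eta$ is presmooth if each $\sim$-class $C$ meets some $\eta$-class $C'$ such that $C\cap C'$ contains two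 disjoint tuples in the same $\mathscr G$-orbit. *)

theory Defs
  imports "HOL-Analysis.Analysis"
begin

text \<open>
  An \<open>n\<close>-tuple over \<open>A\<close> is an extensional function on \<open>{..<n}\<close> with values in \<open>A\<close>, and a
  \<open>k\<close>-ary operation on \<open>A\<close> is an extensional function on the \<open>k\<close>-tuples, so that equality in
  HOL is equality of tuples and of operations. A set of finitary operations is a set of pairs
  \<open>(k, f)\<close>: the arity \<open>k\<close> is recorded because it is not determined by \<open>f\<close> in degenerate cases
  (such as the empty carrier). Clones consist of operations of arity at least 1.
\<close>

definition tuples :: "nat \<Rightarrow> 'a set \<Rightarrow> (nat \<Rightarrow> 'a) set" where
  "tuples n A = ({..<n} \<rightarrow>\<^sub>E A)"

definition operations :: "nat \<Rightarrow> 'a set \<Rightarrow> ((nat \<Rightarrow> 'a) \<Rightarrow> 'a) set" where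
  "operations k A = (tuples k A \<rightarrow>\<^sub>E A)"

definition proj_op :: "'a set \<Rightarrow> nat \<Rightarrow> nat \<Rightarrow> (nat \<Rightarrow> 'a) \<Rightarrow> 'a" where
  "proj_op A k i = (\<lambda>x\<in>tuples k A. x i)"

definition comp_op ::
  "'a set \<Rightarrow> nat \<Rightarrow> nat \<Rightarrow> ((nat \<Rightarrow> 'a) \<Rightarrow> 'a) \<Rightarrow> (nat \<Rightarrow> (nat \<Rightarrow> 'a) \<Rightarrow> 'a) \<Rightarrow> (nat \<Rightarrow> 'a) \<Rightarrow> 'a"
where
  "comp_op A k m f g = (\<lambda>x\<in>tuples m A. f (\<lambda>i\<in>{..<k}. g i x))"

type_synonym 'a opset = "(nat \<times> ((nat \<Rightarrow> 'a) \<Rightarrow> 'a)) set"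

definition function_clone :: "'a set \<Rightarrow> 'a opset \<Rightarrow> bool" where
  "function_clone A C \<longleftrightarrow>
     (\<forall>(k, f) \<in> C. 1 \<le> k \<and> f \<in> operations k A) \<and>
     (\<forall>k. \<forall>i<k. (k, proj_op A k i) \<in> C) \<and>
     (\<forall>k m f g. (k, f) \<in> C \<longrightarrow> (\<forall>i<k. (m, g i) \<in> C) \<longrightarrow> (m, comp_op A k m f g) \<in> C)"

definition proj_clone :: "'a set \<Rightarrow> 'a opset" where
  "proj_clone A = {(k, proj_op A k i) | k i. i < k}"

text \<open>The map sends the \<open>k\<close>-ary operation \<open>f\<close> to the \<open>k\<close>-ary operation \<open>h k f\<close>.\<close>

definition clone_hom ::
  "'a set \<Rightarrow> 'a opset \<Rightarrow> 'b set \<Rightarrow> 'b opset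
    \<Rightarrow> (nat \<Rightarrow> ((nat \<Rightarrow> 'a) \<Rightarrow> 'a) \<Rightarrow> (nat \<Rightarrow> 'b) \<Rightarrow> 'b) \<Rightarrow> bool"
where
  "clone_hom A C B D h \<longleftrightarrow>
     (\<forall>(k, f) \<in> C. (k, h k f) \<in> D) \<and>
     (\<forall>k. \<forall>i<k. h k (proj_op A k i) = proj_op B k i) \<and>
     (\<forall>k m f g. (k, f) \<in> C \<longrightarrow> (\<forall>i<k. (m, g i) \<in> C) \<longrightarrow>
        h m (comp_op A k m f g) = comp_op B k m (h k f) (\<lambda>i. h m (g i)))"

definition equationally_trivial :: "'a set \<Rightarrow> 'a opset \<Rightarrow> bool" where
  "equationally_trivial A C \<longleftrightarrow> (\<exists>h. clone_hom A C {0, 1 :: nat} (proj_clone {0, 1}) h)"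

text \<open>The componentwise action of a \<open>k\<close>-ary operation on \<open>n\<close>-tuples: a \<open>k\<close>-ary operation on
  \<open>tuples n A\<close>.\<close>

definition pow_op ::
  "'a set \<Rightarrow> nat \<Rightarrow> nat \<Rightarrow> ((nat \<Rightarrow> 'a) \<Rightarrow> 'a) \<Rightarrow> (nat \<Rightarrow> nat \<Rightarrow> 'a) \<Rightarrow> nat \<Rightarrow> 'a"
where
  "pow_op A n k f = (\<lambda>t\<in>tuples k (tuples n A). \<lambda>j\<in>{..<n}. f (\<lambda>i\<in>{..<k}. t i j))"

definition invariant_set :: "'a set \<Rightarrow> nat \<Rightarrow> 'a opset \<Rightarrow> (nat \<Rightarrow> 'a) set \<Rightarrow> bool" where
  "invariant_set A n C S \<longleftrightarrow>
     S \<subseteq> tuples n A \<and> (\<forall>(k, f) \<in> C. \<forall>t \<in> tuples k S. pow_op A n k f t \<in> S)"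

definition invariant_rel ::
  "'a set \<Rightarrow> nat \<Rightarrow> 'a opset \<Rightarrow> ((nat \<Rightarrow> 'a) \<times> (nat \<Rightarrow> 'a)) set \<Rightarrow> bool"
where
  "invariant_rel A n C R \<longleftrightarrow>
     R \<subseteq> tuples n A \<times> tuples n A \<and>
     (\<forall>(k, f) \<in> C. \<forall>s \<in> tuples k (tuples n A). \<forall>t \<in> tuples k (tuples n A).
        (\<forall>i<k. (s i, t i) \<in> R) \<longrightarrow> (pow_op A n k f s, pow_op A n k f t) \<in> R)"

text \<open>The operation induced on \<open>X // r\<close> by a \<open>k\<close>-ary operation \<open>f\<close> preserving \<open>X\<close> and the
  equivalence relation \<open>r\<close> on \<open>X\<close>. All members of the union are then the same class.\<close>

definition quot_op ::
  "'b set \<Rightarrow> ('b \<times> 'b) set \<Rightarrow> nat \<Rightarrow> ((nat \<Rightarrow> 'b) \<Rightarrow> 'b) \<Rightarrow> (nat \<Rightarrow> 'b set) \<Rightarrow> 'b set"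
where
  "quot_op X r k f = (\<lambda>c\<in>tuples k (X // r). \<Union>t\<in>(\<Pi>\<^sub>E i\<in>{..<k}. c i). r `` {f t})"

definition unary_functions :: "'a set \<Rightarrow> 'a opset \<Rightarrow> ('a \<Rightarrow> 'a) set" where
  "unary_functions A D = {(\<lambda>x\<in>A. f (\<lambda>i\<in>{..<1}. x)) | f. (1, f) \<in> D}"

definition clone_group :: "'a set \<Rightarrow> 'a opset \<Rightarrow> ('a \<Rightarrow> 'a) set" where
  "clone_group A D =
     {g \<in> unary_functions A D. bij_betw g A A \<and> restrict (inv_into A g) A \<in> unary_functions A D}"

definition act :: "nat \<Rightarrow> ('a \<Rightarrow> 'a) \<Rightarrow> (nat \<Rightarrow> 'a) \<Rightarrow> nat \<Rightarrow> 'a" where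
  "act n g t = (\<lambda>i\<in>{..<n}. g (t i))"

definition orbit_rel ::
  "'a set \<Rightarrow> ('a \<Rightarrow> 'a) set \<Rightarrow> nat \<Rightarrow> ((nat \<Rightarrow> 'a) \<times> (nat \<Rightarrow> 'a)) set"
where
  "orbit_rel A G n = {(s, t). s \<in> tuples n A \<and> (\<exists>g\<in>G. t = act n g s)}"

definition oligomorphic :: "'a set \<Rightarrow> 'a opset \<Rightarrow> bool" where
  "oligomorphic A D \<longleftrightarrow> (\<forall>m. finite (tuples m A // orbit_rel A (clone_group A D) m))"

definition without_algebraicity :: "'a set \<Rightarrow> 'a opset \<Rightarrow> bool" where
  "without_algebraicity A D \<longleftrightarrow>
     (\<forall>F \<subseteq> A. finite F \<longrightarrow>
        (\<forall>x \<in> A - F. infinite {g x | g. g \<in> clone_group A D \<and> (\<forall>y\<in>F. g y = y)}))"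

definition model_complete_core :: "'a set \<Rightarrow> 'a opset \<Rightarrow> bool" where
  "model_complete_core A D \<longleftrightarrow>
     unary_functions A D = product_topology (\<lambda>_. discrete_topology A) A closure_of clone_group A D"

definition canonical :: "'a set \<Rightarrow> nat \<Rightarrow> 'a opset \<Rightarrow> ('a \<Rightarrow> 'a) set \<Rightarrow> bool" where
  "canonical A n C G \<longleftrightarrow> invariant_rel A n C (orbit_rel A G n)"

definition orbit_clone ::
  "'a set \<Rightarrow> nat \<Rightarrow> 'a opset \<Rightarrow> ('a \<Rightarrow> 'a) set \<Rightarrow> (nat \<Rightarrow> 'a) set opset"
where
  "orbit_clone A n C G =
     {(k, quot_op (tuples n A) (orbit_rel A G n) k (pow_op A n k f)) | k f. (k, f) \<in> C}"

definition naked_set ::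
  "'a set \<Rightarrow> nat \<Rightarrow> 'a opset \<Rightarrow> (nat \<Rightarrow> 'a) set \<Rightarrow> ((nat \<Rightarrow> 'a) \<times> (nat \<Rightarrow> 'a)) set \<Rightarrow> bool"
where
  "naked_set A n C S E \<longleftrightarrow>
     invariant_set A n C S \<and> equiv S E \<and> invariant_rel A n C E \<and>
     (\<exists>X \<in> S // E. \<exists>Y \<in> S // E. X \<noteq> Y) \<and>
     (\<forall>(k, f) \<in> C. \<exists>i<k. quot_op S E k (pow_op A n k f) = proj_op (S // E) k i)"

definition invariant_classes ::
  "nat \<Rightarrow> ('a \<Rightarrow> 'a) set \<Rightarrow> (nat \<Rightarrow> 'a) set \<Rightarrow> ((nat \<Rightarrow> 'a) \<times> (nat \<Rightarrow> 'a)) set \<Rightarrow> bool"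
where
  "invariant_classes n G S E \<longleftrightarrow> (\<forall>X \<in> S // E. \<forall>t \<in> X. \<forall>g \<in> G. act n g t \<in> X)"

definition disjoint_tuples :: "nat \<Rightarrow> (nat \<Rightarrow> 'a) \<Rightarrow> (nat \<Rightarrow> 'a) \<Rightarrow> bool" where
  "disjoint_tuples n s t \<longleftrightarrow> s ` {..<n} \<inter> t ` {..<n} = {}"

definition approximates ::
  "'a set \<Rightarrow> nat \<Rightarrow> (nat \<Rightarrow> 'a) set \<Rightarrow> ((nat \<Rightarrow> 'a) \<times> (nat \<Rightarrow> 'a)) set
    \<Rightarrow> (nat \<Rightarrow> 'a) set \<Rightarrow> ((nat \<Rightarrow> 'a) \<times> (nat \<Rightarrow> 'a)) set \<Rightarrow> bool"
where
  "approximates A n S' \<eta> S E \<longleftrightarrow>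
     S \<subseteq> S' \<and> S' \<subseteq> tuples n A \<and> equiv S' \<eta> \<and> \<eta> \<inter> (S \<times> S) \<subseteq> E"

text \<open>Used only for a group \<open>G\<close> that leaves \<open>\<eta>\<close> and the \<open>E\<close>-classes invariant.\<close>

definition presmooth ::
  "'a set \<Rightarrow> nat \<Rightarrow> ('a \<Rightarrow> 'a) set \<Rightarrow> (nat \<Rightarrow> 'a) set \<Rightarrow> ((nat \<Rightarrow> 'a) \<times> (nat \<Rightarrow> 'a)) set
    \<Rightarrow> (nat \<Rightarrow> 'a) set \<Rightarrow> ((nat \<Rightarrow> 'a) \<times> (nat \<Rightarrow> 'a)) set \<Rightarrow> bool"
where
  "presmooth A n G S' \<eta> S E \<longleftrightarrow>
     (\<forall>X \<in> S // E. \<exists>X' \<in> S' // \<eta>. \<exists>s \<in> X \<inter> X'. \<exists>t \<in> X \<inter> X'.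
        disjoint_tuples n s t \<and> (s, t) \<in> orbit_rel A G n)"

end

theory Submission
  imports Defs
begin

text \<open>
  Since \<open>D\<close> is a model-complete core, orbits of \<open>n\<close>-tuples are \<open>D\<close>-invariant, so the clone induced
  by \<open>C\<close> on the finitely many orbits is idempotent. Equational triviality makes its binary operations a
  naked set in a finite power, and fixing coordinates one by one yields a naked set of \<open>C\<close>.

  Among the \<open>D\<close>-invariant sets containing a naked set choose a minimal one, \<open>B\<close>. If (2) fails for a
  naked set \<open>(S, E)\<close> inside \<open>B\<close>, witnessed by \<open>R \<subseteq> B \<times> B\<close>, then no vertex \<open>z\<close> is \<open>R\<close>-adjacent to two
  classes of a naked set: otherwise the \<open>R\<close>-neighbourhood of the orbit of \<open>z\<close> would contain a naked set,
  but it omits \<open>z\<close>. Hence the classes can be pushed along \<open>R\<close> arbitrarily often without merging, that is,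
  being joined by an even \<open>R\<close>-walk refines \<open>E\<close> on \<open>S\<close>. This \<open>D\<close>-invariant equivalence is presmooth:
  for a disjoint edge \<open>(a, b)\<close>, absence of algebraicity moves \<open>a\<close> off itself while fixing \<open>b\<close>.
\<close>

section \<open>Tuples, componentwise operations and quotients\<close>

lemma tuples_mem: "t \<in> tuples n A \<Longrightarrow> i < n \<Longrightarrow> t i \<in> A"
  by (auto simp: tuples_def)

lemma tuples_mono: "A \<subseteq> B \<Longrightarrow> tuples n A \<subseteq> tuples n B"
  by (auto simp: tuples_def PiE_iff)

lemma tuples_restrict: "(\<And>i. i < k \<Longrightarrow> f i \<in> A) \<Longrightarrow> (\<lambda>i\<in>{..<k}. f i) \<in> tuples k A"
  by (auto simp: tuples_def)

lemma tuples_eqI: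
  assumes "s \<in> tuples n A" "t \<in> tuples n B" "\<And>i. i < n \<Longrightarrow> s i = t i"
  shows "s = t"
  by (rule extensionalityI[of s "{..<n}" t]) (use assms in \<open>auto simp: tuples_def PiE_def\<close>)

lemma finite_tuples: "finite A \<Longrightarrow> finite (tuples n A)"
  unfolding tuples_def by (rule finite_PiE) auto

lemma pow_op_apply:
  "t \<in> tuples k (tuples n A) \<Longrightarrow> j < n \<Longrightarrow> pow_op A n k f t j = f (\<lambda>i\<in>{..<k}. t i j)"
  by (simp add: pow_op_def)

lemma pow_op_in_tuples:
  assumes "f \<in> operations k A" "t \<in> tuples k (tuples n A)"
  shows "pow_op A n k f t \<in> tuples n A"
proof -
  have "f (\<lambda>i\<in>{..<k}. t i j) \<in> A" if "j < n" for j
  proof -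
    have "(\<lambda>i\<in>{..<k}. t i j) \<in> tuples k A"
      using assms(2) that by (intro tuples_restrict) (auto dest!: tuples_mem)
    then show ?thesis using assms(1) by (auto simp: operations_def)
  qed
  then show ?thesis using assms(2) by (auto simp: pow_op_def tuples_def)
qed

lemma clone_operations: "function_clone A C \<Longrightarrow> (k, f) \<in> C \<Longrightarrow> f \<in> operations k A"
  by (auto simp: function_clone_def)

lemma clone_comp:
  "function_clone A C \<Longrightarrow> (k, f) \<in> C \<Longrightarrow> (\<And>i. i < k \<Longrightarrow> (m, g i) \<in> C) \<Longrightarrow> (m, comp_op A k m f g) \<in> C"
  by (auto simp: function_clone_def)

lemma clone_proj: "function_clone A C \<Longrightarrow> i < k \<Longrightarrow> (k, proj_op A k i) \<in> C"
  by (auto simp: function_clone_def)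

text \<open>The tuple that is 1 exactly at \<open>i\<close> separates the two projections. So
  projections on a two-element set have a well-defined index, and a clone homomorphism to them
  attaches an index to every operation.\<close>

lemma proj_op_inj:
  assumes "proj_op {0, 1::nat} k i = proj_op {0, 1} k j" "i < k" "j < k"
  shows "i = j"
proof (rule ccontr)
  assume "i \<noteq> j"
  let ?x = "\<lambda>l\<in>{..<k}. if l = i then 1 else 0 :: nat"
  have "?x \<in> tuples k {0, 1}" by (simp add: tuples_restrict)
  then have "?x i = ?x j" using fun_cong[OF assms(1), of ?x] by (simp add: proj_op_def)
  then show False using assms(2,3) \<open>i \<noteq> j\<close> by simp
qed

text \<open>This index rule is what a clone homomorphism to the projections transfers back to the
  indices of the operations in its source.\<close>

lemma comp_op_proj_op:
  assumes "i < k" "\<And>l. l < k \<Longrightarrow> g l = proj_op Y m (j l)" "\<And>l. l < k \<Longrightarrow> j l < m"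
  shows "comp_op Y k m (proj_op Y k i) g = proj_op Y m (j i)"
proof (rule extensionalityI[of _ "tuples m Y"])
  fix x assume x: "x \<in> tuples m Y"
  have "(\<lambda>l\<in>{..<k}. g l x) \<in> tuples k Y"
    using assms(2,3) x by (intro tuples_restrict) (simp add: proj_op_def tuples_mem)
  then show "comp_op Y k m (proj_op Y k i) g x = proj_op Y m (j i) x"
    using x assms(1,2) by (simp add: comp_op_def proj_op_def)
qed (simp_all add: comp_op_def proj_op_def)

lemma clone_hom_comp:
  "clone_hom X F Y H h \<Longrightarrow> (k, f) \<in> F \<Longrightarrow> (\<And>i. i < k \<Longrightarrow> (m, g i) \<in> F) \<Longrightarrow>
    h m (comp_op X k m f g) = comp_op Y k m (h k f) (\<lambda>i. h m (g i))"
  unfolding clone_hom_def by simp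

lemma clone_hom_proj: "clone_hom X F Y H h \<Longrightarrow> i < k \<Longrightarrow> h k (proj_op X k i) = proj_op Y k i"
  unfolding clone_hom_def by simp

lemma pow_op_comp_op:
  assumes "function_clone A C" "(k, f) \<in> C" "\<And>i. i < k \<Longrightarrow> (m, g i) \<in> C"
    and t: "t \<in> tuples m (tuples n A)"
  shows "pow_op A n m (comp_op A k m f g) t = pow_op A n k f (\<lambda>i\<in>{..<k}. pow_op A n m (g i) t)"
    (is "?l = ?r")
proof (rule tuples_eqI)
  have gi: "g i \<in> operations m A" if "i < k" for i
    using clone_operations[OF assms(1) assms(3)[OF that]] .
  have s: "(\<lambda>i\<in>{..<k}. pow_op A n m (g i) t) \<in> tuples k (tuples n A)"
    using pow_op_in_tuples[OF gi t] by (rule tuples_restrict)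
  show "?l \<in> tuples n A"
    using pow_op_in_tuples[OF clone_operations[OF assms(1) clone_comp[OF assms(1-3)]] t] .
  show "?r \<in> tuples n A"
    using pow_op_in_tuples[OF clone_operations[OF assms(1,2)] s] .
  fix j assume j: "j < n"
  have x: "(\<lambda>i\<in>{..<m}. t i j) \<in> tuples m A"
    using t j by (intro tuples_restrict) (auto dest!: tuples_mem)
  show "?l j = ?r j"
    using j x t s by (simp add: pow_op_apply comp_op_def cong: restrict_cong)
qed

lemma pow_op_proj_op:
  assumes "i < k" "t \<in> tuples k (tuples n A)"
  shows "pow_op A n k (proj_op A k i) t = t i"
proof (rule tuples_eqI)
  show "t i \<in> tuples n A" using assms by (simp add: tuples_mem)
  have "proj_op A k i \<in> operations k A"
    using assms(1) by (auto simp: proj_op_def operations_def tuples_mem)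
  then show "pow_op A n k (proj_op A k i) t \<in> tuples n A"
    using assms(2) by (rule pow_op_in_tuples)
  fix j assume j: "j < n"
  have x: "(\<lambda>i\<in>{..<k}. t i j) \<in> tuples k A"
    using tuples_mem[OF tuples_mem[OF assms(2)] j] by (rule tuples_restrict)
  show "pow_op A n k (proj_op A k i) t j = t i j"
    using assms j x by (simp add: pow_op_apply proj_op_def)
qed

text \<open>The union in \<open>quot_op\<close> ranges over all tuples of representatives; by the
  congruence hypothesis its members coincide, and \<open>t\<close> shows that there is at least
  one.\<close>

lemma quot_op_eq:
  assumes "equiv X r" "c \<in> tuples k (X // r)"
    and "\<And>s t. s \<in> (\<Pi>\<^sub>E i\<in>{..<k}. c i) \<Longrightarrow> t \<in> (\<Pi>\<^sub>E i\<in>{..<k}. c i) \<Longrightarrow> (f s, f t) \<in> r"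
    and t: "t \<in> (\<Pi>\<^sub>E i\<in>{..<k}. c i)"
  shows "quot_op X r k f c = r `` {f t}"
proof -
  have "r `` {f s} = r `` {f t}" if "s \<in> (\<Pi>\<^sub>E i\<in>{..<k}. c i)" for s
    using equiv_class_eq[OF assms(1) assms(3)[OF that t]] .
  then have "(\<Union>s\<in>(\<Pi>\<^sub>E i\<in>{..<k}. c i). r `` {f s}) = r `` {f t}" using t by blast
  then show ?thesis using assms(2) by (simp add: quot_op_def)
qed

lemma quotient_tuple_reps:
  assumes "equiv X r" "c \<in> tuples k (X // r)"
  obtains t where "t \<in> (\<Pi>\<^sub>E i\<in>{..<k}. c i)"
proof -
  have "\<exists>x. x \<in> c i" if "i < k" for i
    using in_quotient_imp_non_empty[OF assms(1) tuples_mem[OF assms(2) that]] by blast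
  then have "(\<Pi>\<^sub>E i\<in>{..<k}. c i) \<noteq> {}" by (auto simp: PiE_eq_empty_iff)
  then show ?thesis using that by blast
qed

lemma quotient_reps_mem:
  assumes "equiv X r" "c \<in> tuples k (X // r)" "t \<in> (\<Pi>\<^sub>E i\<in>{..<k}. c i)"
  shows "t \<in> tuples k X" "\<And>i. i < k \<Longrightarrow> c i = r `` {t i}"
proof -
  have *: "c i \<in> X // r" "t i \<in> c i" if "i < k" for i
    using assms that by (auto simp: tuples_def)
  have "t i \<in> X" if "i < k" for i
    using in_quotient_imp_subset[OF assms(1) *(1)[OF that]] *(2)[OF that] by blast
  then show "t \<in> tuples k X" using assms(3) by (auto simp: tuples_def)
  show "c i = r `` {t i}" if "i < k" for i
    using *[OF that] assms(1) by (metis Image_singleton_iff equiv_class_eq_iff quotientE)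
qed

section \<open>The group of a clone\<close>

text \<open>With group elements for the \<open>g i\<close>, this turns the action of
  \<open>f\<close> on several translates of one tuple into the action of a single unary function on
  that tuple.\<close>

lemma unary_functions_comp:
  assumes "function_clone A D" "(k, f) \<in> D" "\<And>i. i < k \<Longrightarrow> g i \<in> unary_functions A D"
  shows "(\<lambda>x\<in>A. f (\<lambda>i\<in>{..<k}. g i x)) \<in> unary_functions A D"
proof -
  have "\<forall>i. \<exists>u. i < k \<longrightarrow> (1, u) \<in> D \<and> g i = (\<lambda>x\<in>A. u (\<lambda>i\<in>{..<1}. x))"
    using assms(3) unfolding unary_functions_def by blast
  then obtain u where u: "\<And>i. i < k \<Longrightarrow> (1, u i) \<in> D"
    "\<And>i. i < k \<Longrightarrow> g i = (\<lambda>x\<in>A. u i (\<lambda>i\<in>{..<1}. x))"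
    by metis
  have "(1, comp_op A k 1 f u) \<in> D" using clone_comp[OF assms(1,2) u(1)] .
  moreover have "(\<lambda>x\<in>A. f (\<lambda>i\<in>{..<k}. g i x)) = (\<lambda>x\<in>A. comp_op A k 1 f u (\<lambda>i\<in>{..<1}. x))"
  proof (rule restrict_ext)
    fix x assume x: "x \<in> A"
    then have "(\<lambda>i\<in>{..<1}. x) \<in> tuples 1 A" by (simp add: tuples_restrict)
    then show "f (\<lambda>i\<in>{..<k}. g i x) = comp_op A k 1 f u (\<lambda>i\<in>{..<1}. x)"
      using x u(2) by (simp add: comp_op_def cong: restrict_cong)
  qed
  ultimately show ?thesis unfolding unary_functions_def by blast
qed

lemma unary_functions_in:
  assumes "function_clone A D" "g \<in> unary_functions A D"
  shows "g \<in> A \<rightarrow>\<^sub>E A"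
proof -
  obtain u where u: "(1, u) \<in> D" "g = (\<lambda>x\<in>A. u (\<lambda>i\<in>{..<1}. x))"
    using assms(2) unfolding unary_functions_def by blast
  have "u \<in> tuples 1 A \<rightarrow>\<^sub>E A"
    using clone_operations[OF assms(1) u(1)] by (simp add: operations_def)
  then have "u (\<lambda>i\<in>{..<1}. x) \<in> A" if "x \<in> A" for x
    by (rule PiE_mem) (simp add: tuples_restrict that)
  then show ?thesis by (simp add: u(2))
qed

lemma unary_functions_compose:
  assumes "function_clone A D" "g \<in> unary_functions A D" "h \<in> unary_functions A D"
  shows "compose A g h \<in> unary_functions A D"
proof -
  obtain u where u: "(1, u) \<in> D" "g = (\<lambda>x\<in>A. u (\<lambda>i\<in>{..<1}. x))"
    using assms(2) unfolding unary_functions_def by blast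
  have "(\<lambda>x\<in>A. u (\<lambda>i\<in>{..<1}. h x)) \<in> unary_functions A D"
    using unary_functions_comp[OF assms(1) u(1), of "\<lambda>_. h"] assms(3) by simp
  moreover have "compose A g h = (\<lambda>x\<in>A. u (\<lambda>i\<in>{..<1}. h x))"
    unfolding compose_def
    by (rule restrict_ext) (use unary_functions_in[OF assms(1,3)] in \<open>auto simp: u(2)\<close>)
  ultimately show ?thesis by simp
qed

lemma unary_functions_id:
  assumes "function_clone A D"
  shows "(\<lambda>x\<in>A. x) \<in> unary_functions A D"
proof -
  have "(1, proj_op A 1 0) \<in> D" using clone_proj[OF assms] by simp
  moreover have "(\<lambda>x\<in>A. x) = (\<lambda>x\<in>A. proj_op A 1 0 (\<lambda>i\<in>{..<1}. x))"
    by (rule restrict_ext) (simp add: proj_op_def tuples_restrict)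
  ultimately show ?thesis unfolding unary_functions_def by blast
qed

locale clone_on =
  fixes A :: "'a set" and D :: "'a opset" and n :: nat
  assumes clone: "function_clone A D"
begin

abbreviation "G \<equiv> clone_group A D"
abbreviation "orb \<equiv> orbit_rel A G n"

lemma G_bij: "g \<in> G \<Longrightarrow> bij_betw g A A"
  by (simp add: clone_group_def)

lemma G_mem: "g \<in> G \<Longrightarrow> x \<in> A \<Longrightarrow> g x \<in> A"
  using G_bij bij_betwE by blast

lemma G_ext: "g \<in> G \<Longrightarrow> g \<in> extensional A"
  using unary_functions_in[OF clone, of g] by (simp add: clone_group_def PiE_def)

lemma G_id: "(\<lambda>x\<in>A. x) \<in> G"
proof -
  have b: "bij_betw (\<lambda>x\<in>A. x) A A" by (auto simp: bij_betw_def inj_on_def)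
  have "inv_into A (\<lambda>x\<in>A. x) x = x" if "x \<in> A" for x
    using bij_betw_inv_into_left[OF b that] that by simp
  then have "restrict (inv_into A (\<lambda>x\<in>A. x)) A = (\<lambda>x\<in>A. x)" by (auto simp: restrict_def)
  then show ?thesis using b unary_functions_id[OF clone] by (simp add: clone_group_def)
qed

lemma G_inv:
  assumes "g \<in> G"
  shows "restrict (inv_into A g) A \<in> G"
proof -
  let ?i = "restrict (inv_into A g) A"
  have b: "bij_betw g A A" by (rule G_bij[OF assms])
  have bi: "bij_betw ?i A A"
    using bij_betw_inv_into[OF b] by (simp cong: bij_betw_cong)
  have "inv_into A ?i x = g x" if "x \<in> A" for x
  proof -
    have "?i (g x) = x" using b that by (simp add: bij_betw_inv_into_left bij_betw_apply)
    then show ?thesis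
      using bij_betw_inv_into_left[OF bi, of "g x"] b that by (simp add: bij_betw_apply)
  qed
  then have "restrict (inv_into A ?i) A = g"
    using G_ext[OF assms] by (auto intro!: extensionalityI[of _ A])
  then show ?thesis using assms bi by (simp add: clone_group_def)
qed

lemma G_compose:
  assumes "g \<in> G" "h \<in> G"
  shows "compose A g h \<in> G"
proof -
  let ?gi = "restrict (inv_into A g) A" and ?hi = "restrict (inv_into A h) A"
  have b: "bij_betw (compose A g h) A A"
    using bij_betw_trans[OF G_bij[OF assms(2)] G_bij[OF assms(1)]]
    by (simp add: compose_def o_def cong: bij_betw_cong)
  have "restrict (inv_into A (compose A g h)) A = compose A ?hi ?gi"
  proof (rule extensionalityI[of _ A])
    fix x assume x: "x \<in> A"
    have gx: "?gi x \<in> A" by (rule G_mem[OF G_inv[OF assms(1)] x])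
    have y: "?hi (?gi x) \<in> A" by (rule G_mem[OF G_inv[OF assms(2)] gx])
    have "compose A g h (?hi (?gi x)) = x"
      using x y gx G_bij[OF assms(1)] G_bij[OF assms(2)]
      by (simp add: compose_def bij_betw_inv_into_right)
    then have "inv_into A (compose A g h) x = ?hi (?gi x)"
      using bij_betw_inv_into_left[OF b y] by simp
    then show "restrict (inv_into A (compose A g h)) A x = compose A ?hi ?gi x"
      using x by (simp add: compose_def)
  qed (simp_all add: compose_def)
  moreover have "compose A ?hi ?gi \<in> unary_functions A D"
    using assms by (intro unary_functions_compose[OF clone]) (auto simp: clone_group_def)
  moreover have "compose A g h \<in> unary_functions A D"
    using assms by (intro unary_functions_compose[OF clone]) (auto simp: clone_group_def)
  ultimately show ?thesis using b by (simp add: clone_group_def)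
qed

lemma act_in_tuples: "g \<in> G \<Longrightarrow> t \<in> tuples n A \<Longrightarrow> act n g t \<in> tuples n A"
  unfolding act_def by (rule tuples_restrict) (simp add: G_mem tuples_mem)

lemma orb_act: "g \<in> G \<Longrightarrow> t \<in> tuples n A \<Longrightarrow> (t, act n g t) \<in> orb"
  by (auto simp: orbit_rel_def)

lemma equiv_orb: "equiv (tuples n A) orb"
proof (rule equivI)
  show "orb \<subseteq> tuples n A \<times> tuples n A" by (auto simp: orbit_rel_def act_in_tuples)
  show "refl_on (tuples n A) orb"
  proof (rule refl_onI)
    fix t assume t: "t \<in> tuples n A"
    have "act n (\<lambda>x\<in>A. x) t = t"
      by (rule tuples_eqI[OF act_in_tuples[OF G_id t] t]) (use t in \<open>simp add: act_def tuples_mem\<close>)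
    then show "(t, t) \<in> orb" using orb_act[OF G_id t] by simp
  qed
  show "sym orb"
  proof (rule symI)
    fix s t assume "(s, t) \<in> orb"
    then obtain g where g: "g \<in> G" "s \<in> tuples n A" "t = act n g s" by (auto simp: orbit_rel_def)
    have t: "t \<in> tuples n A" using g act_in_tuples by simp
    have "act n (restrict (inv_into A g) A) t = s"
      by (rule tuples_eqI[OF act_in_tuples[OF G_inv[OF g(1)] t] g(2)])
        (use g G_bij[OF g(1)] in \<open>simp add: act_def tuples_mem bij_betw_inv_into_left G_mem\<close>)
    then show "(t, s) \<in> orb" using orb_act[OF G_inv[OF g(1)] t] by simp
  qed
  show "trans orb"
  proof (rule transI)
    fix r s t assume "(r, s) \<in> orb" "(s, t) \<in> orb"
    then obtain g h where g: "g \<in> G" "r \<in> tuples n A" "s = act n g r" and h: "h \<in> G" "t = act n h s"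
      by (auto simp: orbit_rel_def)
    have t: "t \<in> tuples n A" using g h act_in_tuples by simp
    have "act n (compose A h g) r = t"
      by (rule tuples_eqI[OF act_in_tuples[OF G_compose[OF h(1) g(1)] g(2)] t])
        (use g h in \<open>simp add: act_def tuples_mem compose_def\<close>)
    then show "(r, t) \<in> orb" using orb_act[OF G_compose[OF h(1) g(1)] g(2)] by simp
  qed
qed

text \<open>Invariance is stated for operations with arity; this translation makes it applicable to
  group elements.\<close>

lemma act_eq_pow_op:
  assumes "g \<in> G"
  obtains u where "(1, u) \<in> D"
    "\<And>t. t \<in> tuples n A \<Longrightarrow> pow_op A n 1 u (\<lambda>i\<in>{..<1}. t) = act n g t"
proof -
  obtain u where u: "(1, u) \<in> D" "g = (\<lambda>x\<in>A. u (\<lambda>i\<in>{..<1}. x))"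
    using assms unfolding clone_group_def unary_functions_def by blast
  have "pow_op A n 1 u (\<lambda>i\<in>{..<1}. t) = act n g t" if t: "t \<in> tuples n A" for t
  proof (rule tuples_eqI)
    have t': "(\<lambda>i\<in>{..<1}. t) \<in> tuples 1 (tuples n A)" using t by (simp add: tuples_restrict)
    show "pow_op A n 1 u (\<lambda>i\<in>{..<1}. t) \<in> tuples n A"
      using pow_op_in_tuples[OF clone_operations[OF clone u(1)] t'] .
    show "act n g t \<in> tuples n A" using act_in_tuples[OF assms t] .
    fix j assume "j < n"
    then show "pow_op A n 1 u (\<lambda>i\<in>{..<1}. t) j = act n g t j"
      using t t' by (simp add: pow_op_apply act_def u(2) tuples_mem cong: restrict_cong)
  qed
  then show ?thesis using that u(1) by blast
qed

lemma invariant_set_act: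
  assumes "invariant_set A n D B" "g \<in> G" "t \<in> B"
  shows "act n g t \<in> B"
proof -
  obtain u where u: "(1, u) \<in> D"
    "\<And>t. t \<in> tuples n A \<Longrightarrow> pow_op A n 1 u (\<lambda>i\<in>{..<1}. t) = act n g t"
    using act_eq_pow_op[OF assms(2)] by blast
  have "(\<lambda>i\<in>{..<1}. t) \<in> tuples 1 B" using assms(3) by (simp add: tuples_restrict)
  then have "pow_op A n 1 u (\<lambda>i\<in>{..<1}. t) \<in> B"
    using assms(1) u(1) unfolding invariant_set_def by blast
  then show ?thesis using u(2) assms(1,3) unfolding invariant_set_def by auto
qed

lemma invariant_set_orb:
  assumes "invariant_set A n D B" "(s, t) \<in> orb" "s \<in> B"
  shows "t \<in> B"
  using assms invariant_set_act by (auto simp: orbit_rel_def)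

lemma invariant_relD:
  assumes "invariant_rel A n D R" "(k, f) \<in> D" "s \<in> tuples k (tuples n A)" "t \<in> tuples k (tuples n A)"
    and "\<And>i. i < k \<Longrightarrow> (s i, t i) \<in> R"
  shows "(pow_op A n k f s, pow_op A n k f t) \<in> R"
  using assms unfolding invariant_rel_def by blast

lemma invariant_rel_act:
  assumes "invariant_rel A n D R" "g \<in> G" "(s, t) \<in> R"
  shows "(act n g s, act n g t) \<in> R"
proof -
  obtain u where u: "(1, u) \<in> D"
    "\<And>t. t \<in> tuples n A \<Longrightarrow> pow_op A n 1 u (\<lambda>i\<in>{..<1}. t) = act n g t"
    using act_eq_pow_op[OF assms(2)] by blast
  have st: "s \<in> tuples n A" "t \<in> tuples n A" using assms unfolding invariant_rel_def by auto
  have "(pow_op A n 1 u (\<lambda>i\<in>{..<1}. s), pow_op A n 1 u (\<lambda>i\<in>{..<1}. t)) \<in> R"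
    by (rule invariant_relD[OF assms(1) u(1)]) (use st assms(3) in \<open>auto intro: tuples_restrict\<close>)
  then show ?thesis using u(2) st by simp
qed

text \<open>Moving the points of \<open>P\<close> away one after the other, each time fixing those already moved.\<close>

lemma move_away:
  assumes na: "without_algebraicity A D"
    and "finite P" "finite Q" "finite W" "P \<subseteq> A" "Q \<subseteq> A" "P \<inter> Q = {}"
  shows "\<exists>g\<in>G. (\<forall>y\<in>Q. g y = y) \<and> g ` P \<inter> W = {}"
  using assms(2,5,7)
proof (induction P rule: finite_induct)
  case empty
  then show ?case using G_id assms(6) by (intro bexI[of _ "\<lambda>x\<in>A. x"]) auto
next
  case (insert p P)
  then obtain g where g: "g \<in> G" "\<forall>y\<in>Q. g y = y" "g ` P \<inter> W = {}" by auto
  let ?F = "Q \<union> g ` P"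
  have inj: "inj_on g A" using G_bij[OF g(1)] by (simp add: bij_betw_def)
  have "g p \<notin> g ` P" using inj insert.hyps insert.prems by (auto dest: inj_onD)
  moreover have "g p \<noteq> y" if "y \<in> Q" for y
    using inj_onD[OF inj, of p y] that g(2) insert.prems assms(6) by auto
  ultimately have "g p \<in> A - ?F" using G_mem[OF g(1)] insert.prems by auto
  moreover have "?F \<subseteq> A" "finite ?F"
    using insert assms(3,6) G_mem[OF g(1)] by auto
  ultimately have "infinite {h (g p) | h. h \<in> G \<and> (\<forall>y\<in>?F. h y = y)}"
    using na unfolding without_algebraicity_def by blast
  then have "\<not> {h (g p) | h. h \<in> G \<and> (\<forall>y\<in>?F. h y = y)} \<subseteq> W"
    using assms(4) finite_subset by blast
  then obtain h where h: "h \<in> G" "\<forall>y\<in>?F. h y = y" "h (g p) \<notin> W" by blast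
  have "\<forall>y\<in>Q. compose A h g y = y" using assms(6) g(2) h(2) by (auto simp: compose_def)
  moreover have "compose A h g ` insert p P \<inter> W = {}"
    using insert.prems g(3) h(2,3) by (auto simp: compose_def)
  ultimately show ?case using G_compose[OF h(1) g(1)] by blast
qed

end

section \<open>Orbits in a model-complete core\<close>

locale core_clone = clone_on +
  assumes core: "model_complete_core A D"
begin

text \<open>The functions on \<open>A\<close> that agree with \<open>f\<close> on the finite set
  \<open>F\<close> form a basic open neighbourhood \<open>?U\<close> of \<open>f\<close>. In a
  model-complete core \<open>f\<close> lies in the closure of \<open>G\<close>, so \<open>?U\<close>
  meets \<open>G\<close>.\<close>

lemma unary_locally_G:
  assumes "f \<in> unary_functions A D" "finite F" "F \<subseteq> A"
  shows "\<exists>g\<in>G. \<forall>x\<in>F. g x = f x"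
proof -
  let ?U = "\<Pi>\<^sub>E x\<in>A. if x \<in> F then {f x} else A"
  have fA: "f \<in> A \<rightarrow>\<^sub>E A" using unary_functions_in[OF clone assms(1)] .
  have "openin (product_topology (\<lambda>_. discrete_topology A) A) ?U"
  proof (rule product_topology_basis)
    show "openin (discrete_topology A) (if x \<in> F then {f x} else A)" for x
      using PiE_mem[OF fA, of x] assms(3) by (simp add: subset_eq)
    have "{x. (if x \<in> F then {f x} else A) \<noteq> topspace (discrete_topology A)} \<subseteq> F" by auto
    then show "finite {x. (if x \<in> F then {f x} else A) \<noteq> topspace (discrete_topology A)}"
      using assms(2) finite_subset by blast
  qed
  moreover have "f \<in> ?U" using fA by (auto simp: PiE_iff)
  moreover have "f \<in> product_topology (\<lambda>_. discrete_topology A) A closure_of G"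
    using core assms(1) by (simp add: model_complete_core_def)
  ultimately obtain g where g: "g \<in> G" "g \<in> ?U" unfolding in_closure_of by blast
  have "g x = f x" if "x \<in> F" for x
    using PiE_mem[OF g(2), of x] that assms(3) by (simp add: subset_eq)
  then show ?thesis using g(1) by blast
qed

text \<open>Write \<open>t i\<close> as the image of \<open>s\<close> under \<open>g i\<close>. Then
  \<open>f\<close> applied to \<open>t\<close> is the image of \<open>s\<close> under the unary
  function sending \<open>x\<close> to \<open>f\<close> of all \<open>g i x\<close>, and on the
  finitely many entries of \<open>s\<close> this function agrees with a group element.\<close>

lemma orb_pow_op:
  assumes "(k, f) \<in> D" "t \<in> tuples k (tuples n A)" "s \<in> tuples n A"
    and "\<And>i. i < k \<Longrightarrow> (s, t i) \<in> orb"
  shows "(s, pow_op A n k f t) \<in> orb"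
proof -
  have "\<forall>i. \<exists>g. i < k \<longrightarrow> g \<in> G \<and> t i = act n g s"
    using assms(4) by (auto simp: orbit_rel_def)
  then obtain g where g: "\<And>i. i < k \<Longrightarrow> g i \<in> G" "\<And>i. i < k \<Longrightarrow> t i = act n (g i) s"
    by metis
  have "(\<lambda>x\<in>A. f (\<lambda>i\<in>{..<k}. g i x)) \<in> unary_functions A D"
    using unary_functions_comp[OF clone assms(1)] g(1) by (auto simp: clone_group_def)
  moreover have sA: "s ` {..<n} \<subseteq> A" using assms(3) by (auto simp: tuples_mem)
  ultimately obtain h where h: "h \<in> G" "\<forall>x\<in>s ` {..<n}. h x = (\<lambda>x\<in>A. f (\<lambda>i\<in>{..<k}. g i x)) x"
    using unary_locally_G by (metis finite_imageI finite_lessThan)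
  have "pow_op A n k f t = act n h s"
  proof (rule tuples_eqI)
    show "pow_op A n k f t \<in> tuples n A"
      using pow_op_in_tuples[OF clone_operations[OF clone assms(1)] assms(2)] .
    show "act n h s \<in> tuples n A" using act_in_tuples[OF h(1) assms(3)] .
    fix j assume j: "j < n"
    have "(\<lambda>i\<in>{..<k}. t i j) = (\<lambda>i\<in>{..<k}. g i (s j))"
      using j g(2) by (intro restrict_ext) (simp add: act_def)
    then show "pow_op A n k f t j = act n h s j"
      using j assms(2,3) h(2) by (simp add: pow_op_apply act_def tuples_mem)
  qed
  then show ?thesis using orb_act[OF h(1) assms(3)] by simp
qed

text \<open>Choose for each argument a neighbour in the orbit of \<open>z\<close>. Applying
  \<open>f\<close> to these stays in the orbit by \<open>orb_pow_op\<close>, and invariance of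
  \<open>R\<close> keeps the results adjacent. Such neighbourhoods are the smaller invariant sets of
  the descent.\<close>

lemma invariant_set_neighbours:
  assumes R: "invariant_rel A n D R" and z: "z \<in> tuples n A"
  shows "invariant_set A n D (R `` (orb `` {z}))"
  unfolding invariant_set_def
proof (intro conjI ballI, goal_cases)
  case 1
  then show ?case using R unfolding invariant_rel_def by auto
next
  case (2 kf)
  obtain k f where kf: "kf = (k, f)" by force
  have "pow_op A n k f t \<in> R `` (orb `` {z})" if t: "t \<in> tuples k (R `` (orb `` {z}))" for t
  proof -
    have "\<forall>i. \<exists>y. i < k \<longrightarrow> (z, y) \<in> orb \<and> (y, t i) \<in> R"
      using tuples_mem[OF t] by blast
    then obtain y where y: "\<And>i. i < k \<Longrightarrow> (z, y i) \<in> orb" "\<And>i. i < k \<Longrightarrow> (y i, t i) \<in> R"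
      by metis
    let ?y = "\<lambda>i\<in>{..<k}. y i"
    have yt: "?y \<in> tuples k (tuples n A)"
      using y(2) R unfolding invariant_rel_def by (intro tuples_restrict) auto
    have tt: "t \<in> tuples k (tuples n A)"
      using tuples_mono[of "R `` (orb `` {z})" "tuples n A" k] t R unfolding invariant_rel_def by auto
    have "(z, pow_op A n k f ?y) \<in> orb"
      by (rule orb_pow_op) (use 2 kf yt z y in auto)
    moreover have "(pow_op A n k f ?y, pow_op A n k f t) \<in> R"
      by (rule invariant_relD[OF R _ yt tt]) (use 2 kf y in auto)
    ultimately show ?thesis by blast
  qed
  then show ?case by (simp add: kf)
qed

end

section \<open>Naked sets\<close>

text \<open>A naked set with \<open>G\<close>-invariant classes in working form: acting as a
  projection is expressed on representatives instead of through \<open>quot_op\<close>, and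
  \<open>C\<close>-invariance of \<open>S\<close> and \<open>E\<close> is left out because it
  follows.\<close>

definition projective_quotient ::
  "'a set \<Rightarrow> nat \<Rightarrow> 'a opset \<Rightarrow> ('a \<Rightarrow> 'a) set \<Rightarrow> (nat \<Rightarrow> 'a) set \<Rightarrow> ((nat \<Rightarrow> 'a) \<times> (nat \<Rightarrow> 'a)) set \<Rightarrow> bool"
where
  "projective_quotient A n C G S E \<longleftrightarrow>
     S \<subseteq> tuples n A \<and> equiv S E \<and> (\<exists>x\<in>S. \<exists>y\<in>S. (x, y) \<notin> E) \<and>
     (\<forall>(k, f) \<in> C. \<exists>i<k. \<forall>t\<in>tuples k S. (t i, pow_op A n k f t) \<in> E) \<and>
     (\<forall>x\<in>S. \<forall>g\<in>G. (x, act n g x) \<in> E)"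

lemma projective_quotientD:
  assumes "projective_quotient A n C G S E"
  shows "S \<subseteq> tuples n A" "equiv S E" "E \<subseteq> S \<times> S"
    "\<And>x. x \<in> S \<Longrightarrow> (x, x) \<in> E"
    "\<And>x y. (x, y) \<in> E \<Longrightarrow> (y, x) \<in> E"
    "\<And>x y z. (x, y) \<in> E \<Longrightarrow> (y, z) \<in> E \<Longrightarrow> (x, z) \<in> E"
    "\<And>x g. x \<in> S \<Longrightarrow> g \<in> G \<Longrightarrow> (x, act n g x) \<in> E"
  using assms unfolding projective_quotient_def
  by (auto elim!: equivE dest: refl_onD symD transD)

lemma projective_quotient_proj:
  assumes "projective_quotient A n C G S E" "(k, f) \<in> C"
  obtains i where "i < k" "\<And>t. t \<in> tuples k S \<Longrightarrow> (t i, pow_op A n k f t) \<in> E"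
  using assms unfolding projective_quotient_def by blast

text \<open>Each \<open>f\<close> sends a tuple into the class of its coordinate \<open>i\<close>.
  This keeps the value in \<open>S\<close>, makes \<open>f\<close> respect \<open>E\<close>, and
  identifies the induced operation with the projection to \<open>i\<close>.\<close>

lemma projective_quotient_naked_set:
  assumes pq: "projective_quotient A n C G S E"
  shows "naked_set A n C S E"
proof -
  note d = projective_quotientD[OF pq]
  have 1: "invariant_set A n C S"
    unfolding invariant_set_def
  proof (intro conjI ballI)
    show "S \<subseteq> tuples n A" by (rule d(1))
    fix kf assume kf: "kf \<in> C"
    obtain k f where [simp]: "kf = (k, f)" by force
    show "case kf of (k, f) \<Rightarrow> \<forall>t\<in>tuples k S. pow_op A n k f t \<in> S"
      using projective_quotient_proj[OF pq, of k f] kf d(3) by (simp) blast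
  qed
  have 2: "invariant_rel A n C E"
    unfolding invariant_rel_def
  proof (intro conjI ballI)
    show "E \<subseteq> tuples n A \<times> tuples n A" using d(1,3) by blast
    fix kf assume kf: "kf \<in> C"
    obtain k f where [simp]: "kf = (k, f)" by force
    obtain i where i: "i < k" "\<And>t. t \<in> tuples k S \<Longrightarrow> (t i, pow_op A n k f t) \<in> E"
      using projective_quotient_proj[OF pq, of k f] kf by auto
    have "(pow_op A n k f s, pow_op A n k f t) \<in> E"
      if "s \<in> tuples k (tuples n A)" "t \<in> tuples k (tuples n A)" "\<forall>i<k. (s i, t i) \<in> E" for s t
    proof -
      have S: "s \<in> tuples k S" "t \<in> tuples k S"
        using that d(3) by (auto simp: tuples_def PiE_iff)
      have "(pow_op A n k f s, s i) \<in> E" using i(2)[OF S(1)] by (rule d(5))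
      moreover have "(s i, pow_op A n k f t) \<in> E"
        using that(3) i(1) i(2)[OF S(2)] by (blast intro: d(6))
      ultimately show ?thesis by (rule d(6))
    qed
    then show "case kf of (k, f) \<Rightarrow> \<forall>s\<in>tuples k (tuples n A). \<forall>t\<in>tuples k (tuples n A).
        (\<forall>i<k. (s i, t i) \<in> E) \<longrightarrow> (pow_op A n k f s, pow_op A n k f t) \<in> E" by simp
  qed
  obtain x y where xy: "x \<in> S" "y \<in> S" "(x, y) \<notin> E"
    using pq unfolding projective_quotient_def by blast
  have 3: "\<exists>X\<in>S // E. \<exists>Y\<in>S // E. X \<noteq> Y"
  proof (intro bexI)
    show "E `` {x} \<noteq> E `` {y}" using xy d(4) by blast
  qed (use xy in \<open>auto intro: quotientI\<close>)
  have 4: "\<exists>i<k. quot_op S E k (pow_op A n k f) = proj_op (S // E) k i" if kf: "(k, f) \<in> C" for k f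
  proof -
    obtain i where i: "i < k" "\<And>t. t \<in> tuples k S \<Longrightarrow> (t i, pow_op A n k f t) \<in> E"
      using projective_quotient_proj[OF pq kf] by blast
    have "quot_op S E k (pow_op A n k f) c = c i" if c: "c \<in> tuples k (S // E)" for c
    proof -
      obtain t where t: "t \<in> (\<Pi>\<^sub>E i\<in>{..<k}. c i)" using quotient_tuple_reps[OF d(2) c] .
      note r = quotient_reps_mem[OF d(2) c]
      have *: "pow_op A n k f s \<in> c i" if "s \<in> (\<Pi>\<^sub>E i\<in>{..<k}. c i)" for s
        using r(1)[OF that] r(2)[OF that i(1)] i(2) by blast
      have ci: "c i \<in> S // E" using tuples_mem[OF c i(1)] .
      have "quot_op S E k (pow_op A n k f) c = E `` {pow_op A n k f t}"
        using * by (intro quot_op_eq[OF d(2) c _ t] in_quotient_imp_in_rel[OF d(2) ci]) simp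
      also have "\<dots> = c i"
        using r(2)[OF t i(1)] equiv_class_eq[OF d(2) i(2)[OF r(1)[OF t]]] by simp
      finally show ?thesis .
    qed
    then have "quot_op S E k (pow_op A n k f) = proj_op (S // E) k i"
      by (intro extensionalityI[of _ "tuples k (S // E)"]) (auto simp: quot_op_def proj_op_def)
    then show ?thesis using i(1) by blast
  qed
  show ?thesis unfolding naked_set_def using 1 2 3 4 d(2) by auto
qed

lemma projective_quotient_invariant_classes:
  assumes pq: "projective_quotient A n C G S E"
  shows "invariant_classes n G S E"
  unfolding invariant_classes_def
proof (intro ballI)
  note d = projective_quotientD[OF pq]
  fix X t g assume "X \<in> S // E" "t \<in> X" "g \<in> G"
  then show "act n g t \<in> X"
    using d(3,6,7) by (auto elim!: quotientE)
qed

text \<open>The index chosen for \<open>f\<close> on \<open>S\<close> still works on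
  \<open>T\<close>; the pair \<open>x\<close>, \<open>y\<close> guarantees that two classes
  survive.\<close>

lemma projective_quotient_restrict:
  assumes pq: "projective_quotient A n C G S E" and T: "T \<subseteq> S"
    and C: "\<And>k f t. (k, f) \<in> C \<Longrightarrow> t \<in> tuples k T \<Longrightarrow> pow_op A n k f t \<in> T"
    and G: "\<And>g t. g \<in> G \<Longrightarrow> t \<in> T \<Longrightarrow> act n g t \<in> T"
    and xy: "x \<in> T" "y \<in> T" "(x, y) \<notin> E"
  shows "projective_quotient A n C G T (E \<inter> T \<times> T)"
proof -
  note d = projective_quotientD[OF pq]
  have "equiv T (E \<inter> T \<times> T)"
    using T d(4,5,6) by (intro equivI refl_onI symI transI) blast+
  moreover have "\<exists>i<k. \<forall>t\<in>tuples k T. (t i, pow_op A n k f t) \<in> E \<inter> T \<times> T" if kf: "(k, f) \<in> C" for k f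
  proof -
    obtain i where i: "i < k" "\<And>t. t \<in> tuples k S \<Longrightarrow> (t i, pow_op A n k f t) \<in> E"
      using projective_quotient_proj[OF pq kf] by blast
    then show ?thesis using C[OF kf] tuples_mono[OF T] tuples_mem by blast
  qed
  ultimately show ?thesis
    unfolding projective_quotient_def using T d(1,7) xy G by auto
qed

text \<open>By \<open>single\<close>, a vertex has all its neighbours in \<open>S\<close> in one
  class, so it can inherit that class. An operation applied to vertices is adjacent to its value on
  chosen neighbours, so the projection index is inherited too. The second conclusion says that
  classes do not merge.\<close>

lemma projective_quotient_neighbours:
  assumes pq: "projective_quotient A n C (clone_group A D) S E" and clone: "function_clone A D"
    and "C \<subseteq> D" and R: "invariant_rel A n D R"
    and single: "\<And>u v z. u \<in> S \<Longrightarrow> v \<in> S \<Longrightarrow> (u, z) \<in> R \<Longrightarrow> (v, z) \<in> R \<Longrightarrow> (u, v) \<in> E"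
    and x: "x \<in> S" "(x, x') \<in> R" and y: "y \<in> S" "(y, y') \<in> R" and xy: "(x, y) \<notin> E"
  shows "projective_quotient A n C (clone_group A D) (R `` S) (R\<inverse> O E O R)"
    and "(x', y') \<notin> R\<inverse> O E O R"
proof -
  interpret clone_on A D n by (standard) (rule clone)
  note d = projective_quotientD[OF pq]
  have E': "(a', b') \<in> R\<inverse> O E O R \<longleftrightarrow> (\<exists>a b. (a, b) \<in> E \<and> (a, a') \<in> R \<and> (b, b') \<in> R)" for a' b'
    by blast
  show nxy: "(x', y') \<notin> R\<inverse> O E O R"
  proof
    assume "(x', y') \<in> R\<inverse> O E O R"
    then obtain u v where uv: "(u, v) \<in> E" "(u, x') \<in> R" "(v, y') \<in> R" unfolding E' by blast
    then have uvS: "u \<in> S" "v \<in> S" using d(3) by auto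
    have "(x, u) \<in> E" "(v, y) \<in> E" using single x y uv uvS by blast+
    then show False using xy uv(1) d(6) by blast
  qed
  have RA: "R `` S \<subseteq> tuples n A" using R unfolding invariant_rel_def by auto
  have "equiv (R `` S) (R\<inverse> O E O R)"
  proof (rule equivI)
    show "R\<inverse> O E O R \<subseteq> R `` S \<times> R `` S" using d(3) by blast
    show "refl_on (R `` S) (R\<inverse> O E O R)" using d(4) by (intro refl_onI) blast
    show "sym (R\<inverse> O E O R)" using d(5) by (intro symI) blast
    show "trans (R\<inverse> O E O R)"
    proof (rule transI)
      fix a b c assume "(a, b) \<in> R\<inverse> O E O R" "(b, c) \<in> R\<inverse> O E O R"
      then obtain a1 b1 b2 c2 where *: "(a1, b1) \<in> E" "(b2, c2) \<in> E" "(a1, a) \<in> R" "(b1, b) \<in> R"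
        "(b2, b) \<in> R" "(c2, c) \<in> R" unfolding E' by blast
      \<comment> \<open>\<open>b1\<close> and \<open>b2\<close> have the common neighbour
        \<open>b\<close>, so \<open>single\<close> puts them in one class.\<close>
      then have "(b1, b2) \<in> E" using single d(3) by blast
      then have "(a1, c2) \<in> E" using * d(6) by blast
      then show "(a, c) \<in> R\<inverse> O E O R" using * unfolding E' by blast
    qed
  qed
  moreover have "\<exists>i<k. \<forall>t\<in>tuples k (R `` S). (t i, pow_op A n k f t) \<in> R\<inverse> O E O R"
    if kf: "(k, f) \<in> C" for k f
  proof -
    obtain i where i: "i < k" "\<And>t. t \<in> tuples k S \<Longrightarrow> (t i, pow_op A n k f t) \<in> E"
      using projective_quotient_proj[OF pq kf] by blast
    have "(t i, pow_op A n k f t) \<in> R\<inverse> O E O R" if t: "t \<in> tuples k (R `` S)" for t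
    proof -
      have "\<forall>i. \<exists>s. i < k \<longrightarrow> s \<in> S \<and> (s, t i) \<in> R" using tuples_mem[OF t] by blast
      then obtain s where s: "\<And>i. i < k \<Longrightarrow> s i \<in> S" "\<And>i. i < k \<Longrightarrow> (s i, t i) \<in> R" by metis
      let ?s = "\<lambda>i\<in>{..<k}. s i"
      have sS: "?s \<in> tuples k S" using s by (simp add: tuples_restrict)
      have "(pow_op A n k f ?s, pow_op A n k f t) \<in> R"
        by (rule invariant_relD[OF R])
          (use kf assms(3) subsetD[OF tuples_mono[OF d(1)] sS] subsetD[OF tuples_mono[OF RA] t] s in auto)
      then show ?thesis using i(2)[OF sS] i(1) s unfolding E' by auto
    qed
    then show ?thesis using i(1) by blast
  qed
  moreover have "(b, act n g b) \<in> R\<inverse> O E O R" if "b \<in> R `` S" "g \<in> G" for b g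
    using that d(7) invariant_rel_act[OF R] unfolding E' by blast
  ultimately show "projective_quotient A n C G (R `` S) (R\<inverse> O E O R)"
    unfolding projective_quotient_def using RA nxy x y by blast
qed

section \<open>Even walks\<close>

text \<open>For symmetric \<open>R\<close> this is the equivalence generated by having a common
  neighbour. The exponent 0 contributes the identity on the whole type, which the intersection cuts
  down to the vertices of \<open>R\<close>.\<close>

definition linked :: "('b \<times> 'b) set \<Rightarrow> ('b \<times> 'b) set" where
  "linked R = (\<Union>j. R ^^ (2 * j)) \<inter> Domain R \<times> Domain R"

text \<open>Going back and forth along an edge at \<open>x\<close> lengthens a walk by two.\<close>

lemma even_walk_mono:
  assumes "sym R" "(x, y) \<in> R ^^ (2 * i)" "x \<in> Domain R" "i \<le> j"
  shows "(x, y) \<in> R ^^ (2 * j)"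
proof -
  obtain m where j: "j = m + i" using assms(4) by (metis add.commute le_Suc_ex)
  have "(x, x) \<in> R ^^ (2 * m)" for m
  proof (induction m)
    case (Suc m)
    obtain w where "(x, w) \<in> R" "(w, x) \<in> R" using assms(1,3) by (auto dest: symD)
    then have "(x, x) \<in> R ^^ Suc (Suc (2 * m))" using Suc by (auto intro: relcompI)
    then show ?case by simp
  qed simp
  then have "(x, y) \<in> R ^^ (2 * m) O R ^^ (2 * i)" using assms(2) by blast
  then show ?thesis by (simp add: j relpow_add distrib_left)
qed

lemma equiv_linked:
  assumes "sym R"
  shows "equiv (Domain R) (linked R)"
proof (rule equivI)
  show "linked R \<subseteq> Domain R \<times> Domain R" by (auto simp: linked_def)
  show "refl_on (Domain R) (linked R)"
    by (rule refl_onI) (auto simp: linked_def intro!: exI[of _ 0])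
  have "sym (R ^^ m)" for m
  proof (induction m)
    case (Suc m)
    show ?case
    proof (rule symI)
      fix a b assume "(a, b) \<in> R ^^ Suc m"
      then obtain c where "(a, c) \<in> R ^^ m" "(c, b) \<in> R" by (rule relpow_Suc_E)
      then show "(b, a) \<in> R ^^ Suc m"
        using symD[OF Suc] symD[OF assms] by (blast intro: relpow_Suc_I2)
    qed
  qed (simp add: sym_Id)
  then show "sym (linked R)" by (intro symI) (auto simp: linked_def dest: symD)
  show "trans (linked R)"
  proof (rule transI)
    fix a b c assume "(a, b) \<in> linked R" "(b, c) \<in> linked R"
    then obtain i j where "(a, b) \<in> R ^^ (2 * i)" "(b, c) \<in> R ^^ (2 * j)"
      and "a \<in> Domain R" "c \<in> Domain R" by (auto simp: linked_def)
    moreover from this have "(a, c) \<in> R ^^ (2 * (i + j))" by (auto simp: relpow_add distrib_left)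
    ultimately show "(a, c) \<in> linked R" unfolding linked_def by blast
  qed
qed

context core_clone
begin

text \<open>If two inequivalent elements are joined by an even walk, push \<open>S\<close> along \<open>R\<close> until some vertex
  \<open>z\<close> sees two classes; its neighbourhood then carries a projective quotient.\<close>

lemma even_walk_split:
  assumes CD: "C \<subseteq> D" and R: "invariant_rel A n D R"
  shows "projective_quotient A n C G S E \<Longrightarrow> x \<in> S \<Longrightarrow> y \<in> S \<Longrightarrow> (x, y) \<notin> E \<Longrightarrow> sym R \<Longrightarrow>
    (x, y) \<in> R ^^ (2 * j) \<Longrightarrow>
    \<exists>T F. \<exists>z\<in>Range R. projective_quotient A n C G T F \<and> T \<subseteq> R `` (orb `` {z})"
proof (induction j arbitrary: S E x y)
  case 0
  then show ?case using projective_quotientD(4) by fastforce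
next
  case (Suc j)
  note pq = Suc.prems(1) and d = projective_quotientD[OF Suc.prems(1)]
  show ?case
  proof (cases "\<exists>u\<in>S. \<exists>v\<in>S. \<exists>z. (u, z) \<in> R \<and> (v, z) \<in> R \<and> (u, v) \<notin> E")
    case True
    then obtain u v z where uv: "u \<in> S" "v \<in> S" "(u, z) \<in> R" "(v, z) \<in> R" "(u, v) \<notin> E" by blast
    have z: "z \<in> tuples n A" using uv(3) R unfolding invariant_rel_def by auto
    let ?N = "R `` (orb `` {z})"
    have N: "invariant_set A n D ?N" using invariant_set_neighbours[OF R z] .
    have zz: "(z, z) \<in> orb" using equiv_orb z by (auto elim!: equivE dest: refl_onD)
    \<comment> \<open>Both \<open>u\<close> and \<open>v\<close> lie in \<open>?N\<close>, since
      \<open>R\<close> is symmetric and \<open>z\<close> belongs to its own orbit; hence two classes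
      of \<open>S\<close> remain inside the neighbourhood.\<close>
    have "projective_quotient A n C G (S \<inter> ?N) (E \<inter> (S \<inter> ?N) \<times> (S \<inter> ?N))"
    proof (rule projective_quotient_restrict[OF pq])
      fix k f t assume kf: "(k, f) \<in> C" and t: "t \<in> tuples k (S \<inter> ?N)"
      have tS: "t \<in> tuples k S" and tN: "t \<in> tuples k ?N" using t by (auto simp: tuples_def PiE_iff)
      have "pow_op A n k f t \<in> S"
        using projective_quotient_proj[OF pq kf] tS d(3) by blast
      moreover have "pow_op A n k f t \<in> ?N"
        using N kf CD tN unfolding invariant_set_def by blast
      ultimately show "pow_op A n k f t \<in> S \<inter> ?N" by blast
    next
      fix g t assume "g \<in> G" "t \<in> S \<inter> ?N"
      then show "act n g t \<in> S \<inter> ?N" using d(3,7) invariant_set_act[OF N] by blast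
    next
      show "u \<in> S \<inter> ?N" "v \<in> S \<inter> ?N" using uv zz symD[OF Suc.prems(5)] by blast+
    qed (use uv in auto)
    then show ?thesis using uv(3) by blast
  next
    case False
    have "(x, y) \<in> R ^^ (Suc (Suc (2 * j)))" using Suc.prems(6) by simp
    then obtain y' where y': "(x, y') \<in> R ^^ Suc (2 * j)" "(y', y) \<in> R" by (rule relpow_Suc_E)
    then obtain x' where x': "(x, x') \<in> R" "(x', y') \<in> R ^^ (2 * j)" by (meson relpow_Suc_D2)
    have yy: "(y, y') \<in> R" using y'(2) symD[OF Suc.prems(5)] by blast
    note n = projective_quotient_neighbours[OF pq clone CD R _ Suc.prems(2) x'(1) Suc.prems(3) yy Suc.prems(4)]
    show ?thesis
      by (rule Suc.IH[OF n(1) _ _ n(2) Suc.prems(5) x'(2)])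
        (use False Suc.prems(2,3) x'(1) yy in blast)+
  qed
qed

text \<open>The walks in all coordinates have the same length \<open>m\<close>, so \<open>f\<close>
  can be applied to their vertices simultaneously, one edge at a time.\<close>

lemma pow_op_walk:
  assumes R: "invariant_rel A n D R" and kf: "(k, f) \<in> D"
  shows "s \<in> tuples k (tuples n A) \<Longrightarrow> t \<in> tuples k (tuples n A) \<Longrightarrow>
    (\<And>i. i < k \<Longrightarrow> (s i, t i) \<in> R ^^ m) \<Longrightarrow> (pow_op A n k f s, pow_op A n k f t) \<in> R ^^ m"
proof (induction m arbitrary: t)
  case 0
  then have "s = t" by (intro tuples_eqI[of s k _ t]) auto
  then show ?case by simp
next
  case (Suc m)
  have "\<forall>i. \<exists>r. i < k \<longrightarrow> (s i, r) \<in> R ^^ m \<and> (r, t i) \<in> R" using Suc.prems(3) by force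
  then obtain r where r: "\<And>i. i < k \<Longrightarrow> (s i, r i) \<in> R ^^ m" "\<And>i. i < k \<Longrightarrow> (r i, t i) \<in> R" by metis
  let ?r = "\<lambda>i\<in>{..<k}. r i"
  have rt: "?r \<in> tuples k (tuples n A)"
    using r(2) R unfolding invariant_rel_def by (intro tuples_restrict) auto
  have "(pow_op A n k f s, pow_op A n k f ?r) \<in> R ^^ m"
    by (rule Suc.IH[OF Suc.prems(1) rt]) (simp add: r(1))
  moreover have "(pow_op A n k f ?r, pow_op A n k f t) \<in> R"
    by (rule invariant_relD[OF R kf rt Suc.prems(2)]) (simp add: r(2))
  ultimately show ?case by auto
qed

lemma invariant_set_Domain:
  assumes R: "invariant_rel A n D R"
  shows "invariant_set A n D (Domain R)"
  unfolding invariant_set_def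
proof (intro conjI ballI, goal_cases)
  case 1
  then show ?case using R unfolding invariant_rel_def by auto
next
  case (2 kf)
  obtain k f where kf: "kf = (k, f)" by force
  have "pow_op A n k f t \<in> Domain R" if t: "t \<in> tuples k (Domain R)" for t
  proof -
    have "\<forall>i. \<exists>y. i < k \<longrightarrow> (t i, y) \<in> R" using tuples_mem[OF t] by blast
    then obtain y where y: "\<And>i. i < k \<Longrightarrow> (t i, y i) \<in> R" by metis
    have "(pow_op A n k f t, pow_op A n k f (\<lambda>i\<in>{..<k}. y i)) \<in> R"
    proof (rule invariant_relD[OF R])
      show "(\<lambda>i\<in>{..<k}. y i) \<in> tuples k (tuples n A)"
        using y R unfolding invariant_rel_def by (intro tuples_restrict) auto
      show "t \<in> tuples k (tuples n A)"
        using tuples_mono[of "Domain R" "tuples n A" k] t R unfolding invariant_rel_def by auto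
    qed (use 2 kf y in auto)
    then show ?thesis by blast
  qed
  then show ?case by (simp add: kf)
qed

text \<open>The even walks in the \<open>k\<close> coordinates may have different lengths. Padding
  each to the sum of all lengths with \<open>even_walk_mono\<close> makes \<open>pow_op_walk\<close>
  applicable.\<close>

lemma invariant_rel_linked:
  assumes R: "invariant_rel A n D R" and "sym R"
  shows "invariant_rel A n D (linked R)"
  unfolding invariant_rel_def
proof (intro conjI ballI, goal_cases)
  case 1
  then show ?case using R unfolding invariant_rel_def linked_def by auto
next
  case (2 kf)
  obtain k f where kf: "kf = (k, f)" by force
  have "(pow_op A n k f s, pow_op A n k f t) \<in> linked R"
    if st: "s \<in> tuples k (tuples n A)" "t \<in> tuples k (tuples n A)" "\<forall>i<k. (s i, t i) \<in> linked R" for s t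
  proof -
    have "\<forall>i. \<exists>j. i < k \<longrightarrow> (s i, t i) \<in> R ^^ (2 * j)" using st(3) unfolding linked_def by blast
    then obtain j where j: "\<And>i. i < k \<Longrightarrow> (s i, t i) \<in> R ^^ (2 * j i)" by metis
    have *: "(s i, t i) \<in> R ^^ (2 * (\<Sum>i<k. j i))" if "i < k" for i
    proof (rule even_walk_mono[OF assms(2) j[OF that]])
      show "s i \<in> Domain R" using st(3) that by (auto simp: linked_def)
      show "j i \<le> (\<Sum>i<k. j i)" using that by (intro member_le_sum) auto
    qed
    have "(pow_op A n k f s, pow_op A n k f t) \<in> R ^^ (2 * (\<Sum>i<k. j i))"
      by (rule pow_op_walk[OF R _ st(1,2) *]) (use 2 kf in auto)
    moreover have "s \<in> tuples k (Domain R)" "t \<in> tuples k (Domain R)"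
      using st by (auto simp: tuples_def PiE_iff linked_def)
    then have "pow_op A n k f s \<in> Domain R" "pow_op A n k f t \<in> Domain R"
      using invariant_set_Domain[OF R] 2 kf unfolding invariant_set_def by blast+
    ultimately show ?thesis unfolding linked_def by blast
  qed
  then show ?case by (simp add: kf)
qed

section \<open>The dichotomy\<close>

text \<open>Presmoothness concerns every class, but a disjoint edge is known only at the classes of
  \<open>a\<close> and \<open>b\<close>. So \<open>S\<close> is cut down to these two classes, and
  further to \<open>Domain R\<close>, on which \<open>linked R\<close> is an equivalence.\<close>

lemma presmooth_linked:
  assumes na: "without_algebraicity A D" and CD: "C \<subseteq> D"
    and pq: "projective_quotient A n C G S E"
    and R: "invariant_rel A n D R" "sym R"
    and ab: "a \<in> S" "b \<in> S" "disjoint_tuples n a b" "(a, b) \<notin> E" "(a, b) \<in> R"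
    and lE: "linked R \<inter> S \<times> S \<subseteq> E"
  shows "\<exists>T F. projective_quotient A n C G T F \<and> approximates A n (Domain R) (linked R) T F \<and>
    presmooth A n G (Domain R) (linked R) T F"
proof -
  note d = projective_quotientD[OF pq]
  let ?T = "(E `` {a} \<union> E `` {b}) \<inter> Domain R"
  let ?F = "E \<inter> ?T \<times> ?T"
  have dom: "invariant_set A n D (Domain R)" using invariant_set_Domain[OF R(1)] .
  have T: "?T \<subseteq> S" using d(3) by blast
  have abT: "a \<in> ?T" "b \<in> ?T" using ab d(4) symD[OF R(2)] by blast+
  have pqT: "projective_quotient A n C G ?T ?F"
  proof (rule projective_quotient_restrict[OF pq T _ _ abT ab(4)])
    fix k f t assume kf: "(k, f) \<in> C" and t: "t \<in> tuples k ?T"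
    have tS: "t \<in> tuples k S" using t tuples_mono[OF T] by blast
    have tN: "t \<in> tuples k (Domain R)" using t tuples_mono[of ?T "Domain R" k] by blast
    obtain i where i: "i < k" "(t i, pow_op A n k f t) \<in> E"
      using projective_quotient_proj[OF pq kf] tS by blast
    have "pow_op A n k f t \<in> E `` {a} \<union> E `` {b}"
      using tuples_mem[OF t i(1)] i(2) d(6) by blast
    moreover have "pow_op A n k f t \<in> Domain R"
      using dom kf CD tN unfolding invariant_set_def by blast
    ultimately show "pow_op A n k f t \<in> ?T" by blast
  next
    fix g t assume "g \<in> G" "t \<in> ?T"
    then show "act n g t \<in> ?T" using T d(6,7) invariant_set_act[OF dom] by blast
  qed
  have app: "approximates A n (Domain R) (linked R) ?T ?F"
    unfolding approximates_def
    using equiv_linked[OF R(2)] dom lE T unfolding invariant_set_def by blast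
  \<comment> \<open>Fix the entries of \<open>q\<close> and move those of \<open>p\<close> off
    themselves by some \<open>g\<close> in \<open>G\<close>. Then \<open>p\<close> and its image are
    disjoint, lie in one orbit and in the \<open>G\<close>-invariant class \<open>X\<close>, and are
    linked through their common neighbour \<open>q\<close>.\<close>
  have key: "\<exists>X'\<in>Domain R // linked R. \<exists>s\<in>X \<inter> X'. \<exists>t\<in>X \<inter> X'. disjoint_tuples n s t \<and> (s, t) \<in> orb"
    if X: "X \<in> ?T // ?F" and p: "p \<in> X" "(p, q) \<in> R" "disjoint_tuples n p q" for X p q
  proof -
    have pt: "p \<in> tuples n A" and qt: "q \<in> tuples n A"
      using p(2) R(1) unfolding invariant_rel_def by auto
    obtain g where g: "g \<in> G" "\<forall>y\<in>q ` {..<n}. g y = y" "g ` (p ` {..<n}) \<inter> p ` {..<n} = {}"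
      using move_away[OF na, of "p ` {..<n}" "q ` {..<n}" "p ` {..<n}"] p(3) pt qt tuples_mem
      unfolding disjoint_tuples_def by (metis finite_imageI finite_lessThan image_subsetI lessThan_iff)
    have "act n g q = q"
      by (rule tuples_eqI[OF act_in_tuples[OF g(1) qt] qt]) (use g(2) in \<open>auto simp: act_def\<close>)
    then have gR: "(act n g p, q) \<in> R" using invariant_rel_act[OF R(1) g(1) p(2)] by simp
    have "(p, act n g p) \<in> R ^^ (2 * 1)"
      using p(2) gR symD[OF R(2)] by (auto simp: numeral_2_eq_2)
    then have l: "(p, act n g p) \<in> linked R" using p(2) gR unfolding linked_def by blast
    have "disjoint_tuples n p (act n g p)"
      using g(3) unfolding disjoint_tuples_def act_def by auto
    moreover have "(p, act n g p) \<in> orb" using orb_act[OF g(1) pt] .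
    moreover have "act n g p \<in> X"
      using projective_quotient_invariant_classes[OF pqT] X p(1) g(1)
      unfolding invariant_classes_def by blast
    moreover have "p \<in> linked R `` {p}" 
      using equiv_class_self[OF equiv_linked[OF R(2)]] p(2) by blast
    moreover have "linked R `` {p} \<in> Domain R // linked R" using p(2) by (blast intro: quotientI)
    ultimately show ?thesis using p(1) l by blast
  qed
  have "presmooth A n G (Domain R) (linked R) ?T ?F"
    unfolding presmooth_def
  proof
    fix X assume X: "X \<in> ?T // ?F"
    then obtain c where c: "c \<in> ?T" "X = ?F `` {c}" by (auto elim!: quotientE)
    then consider "(a, c) \<in> E" | "(b, c) \<in> E" by blast
    then show "\<exists>X'\<in>Domain R // linked R. \<exists>s\<in>X \<inter> X'. \<exists>t\<in>X \<inter> X'. disjoint_tuples n s t \<and> (s, t) \<in> orb"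
    proof cases
      case 1
      then have "a \<in> X" using c abT d(5) by blast
      then show ?thesis using key[OF X _ ab(5,3)] by blast
    next
      case 2
      then have "b \<in> X" using c abT d(5) by blast
      moreover have "(b, a) \<in> R" "disjoint_tuples n b a"
        using ab symD[OF R(2)] by (auto simp: disjoint_tuples_def)
      ultimately show ?thesis using key[OF X] by blast
    qed
  qed
  then show ?thesis using pqT app by blast
qed

text \<open>Minimality of \<open>B\<close> takes the form of an induction on the number of orbits
  contained in \<open>B\<close>, which is finite by oligomorphicity. If both alternatives fail for
  \<open>(S, E)\<close>, a different projective quotient is found inside a smaller invariant
  set.\<close>

lemma naked_set_dichotomy:
  assumes olig: "oligomorphic A D" and na: "without_algebraicity A D" and CD: "C \<subseteq> D"
  shows "invariant_set A n D B \<Longrightarrow> projective_quotient A n C G S E \<Longrightarrow> S \<subseteq> B \<Longrightarrow>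
    \<exists>S E. projective_quotient A n C G S E \<and>
    ((\<exists>S' \<eta>. approximates A n S' \<eta> S E \<and> invariant_rel A n D \<eta> \<and> presmooth A n G S' \<eta> S E) \<or>
     (\<forall>R. R \<subseteq> tuples n A \<times> tuples n A \<and> invariant_rel A n D R \<and> sym R \<and>
        (\<exists>a\<in>S. \<exists>b\<in>S. disjoint_tuples n a b \<and> (a, b) \<notin> E \<and> (a, b) \<in> R) \<longrightarrow>
        (\<exists>c c'. (c, c') \<in> R \<and> (c, c') \<in> orb)))"
proof (induction "card {X \<in> tuples n A // orb. X \<subseteq> B}" arbitrary: B S E rule: less_induct)
  case less
  note B = less.prems(1) and pq = less.prems(2)
  show ?case
  proof (cases "\<forall>R. R \<subseteq> tuples n A \<times> tuples n A \<and> invariant_rel A n D R \<and> sym R \<and>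
        (\<exists>a\<in>S. \<exists>b\<in>S. disjoint_tuples n a b \<and> (a, b) \<notin> E \<and> (a, b) \<in> R) \<longrightarrow>
        (\<exists>c c'. (c, c') \<in> R \<and> (c, c') \<in> orb)")
    case True
    then show ?thesis using pq by blast
  next
    case False
    then obtain R0 a b where R0: "invariant_rel A n D R0" "sym R0"
        "\<And>c c'. (c, c') \<in> R0 \<Longrightarrow> (c, c') \<notin> orb"
      and ab: "a \<in> S" "b \<in> S" "disjoint_tuples n a b" "(a, b) \<notin> E" "(a, b) \<in> R0"
      by blast
    \<comment> \<open>Cutting \<open>R0\<close> down to the invariant set \<open>B\<close> preserves
      invariance and keeps all neighbourhoods inside \<open>B\<close>.\<close>
    define R where "R = R0 \<inter> B \<times> B"
    have BA: "B \<subseteq> tuples n A" using B unfolding invariant_set_def by blast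
    have R: "invariant_rel A n D R"
      unfolding invariant_rel_def
    proof (intro conjI ballI, goal_cases)
      case 1
      then show ?case using BA unfolding R_def by blast
    next
      case (2 kf)
      obtain k f where kf: "kf = (k, f)" by force
      have "(pow_op A n k f s, pow_op A n k f t) \<in> R"
        if st: "s \<in> tuples k (tuples n A)" "t \<in> tuples k (tuples n A)" "\<forall>i<k. (s i, t i) \<in> R" for s t
      proof -
        have "s \<in> tuples k B" "t \<in> tuples k B"
          using st by (auto simp: tuples_def PiE_iff R_def)
        then have "pow_op A n k f s \<in> B" "pow_op A n k f t \<in> B"
          using B 2 kf unfolding invariant_set_def by blast+
        moreover have "(pow_op A n k f s, pow_op A n k f t) \<in> R0"
          by (rule invariant_relD[OF R0(1) _ st(1,2)]) (use 2 kf st(3) in \<open>auto simp: R_def\<close>)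
        ultimately show ?thesis by (simp add: R_def)
      qed
      then show ?case by (simp add: kf)
    qed
    have symR: "sym R" using R0(2) by (auto simp: R_def sym_def)
    have abR: "(a, b) \<in> R" using ab less.prems(3) by (auto simp: R_def)
    show ?thesis
    proof (cases "linked R \<inter> S \<times> S \<subseteq> E")
      case True
      then show ?thesis
        using presmooth_linked[OF na CD pq R symR ab(1-4) abR] invariant_rel_linked[OF R symR] by blast
    next
      case False
      then obtain x y j where "x \<in> S" "y \<in> S" "(x, y) \<notin> E" "(x, y) \<in> R ^^ (2 * j)"
        by (auto simp: linked_def)
      then obtain T F z where z: "z \<in> Range R" and T: "projective_quotient A n C G T F"
          "T \<subseteq> R `` (orb `` {z})"
        using even_walk_split[OF CD R pq _ _ _ symR] by blast
      let ?N = "R `` (orb `` {z})"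
      have zB: "z \<in> B" using z by (auto simp: R_def)
      then have zA: "z \<in> tuples n A" using BA by blast
      \<comment> \<open>An edge from the orbit of \<open>z\<close> to \<open>z\<close> would be a
        pair of \<open>R0\<close> inside one orbit. So the orbit of \<open>z\<close> is contained in
        \<open>B\<close> but not in \<open>?N\<close>, and the measure drops.\<close>
      have "z \<notin> ?N"
      proof
        assume "z \<in> ?N"
        then obtain w where w: "(z, w) \<in> orb" "(w, z) \<in> R" by blast
        then have "(w, z) \<in> orb" using equiv_orb by (auto elim!: equivE dest: symD)
        then show False using w(2) R0(3) by (auto simp: R_def)
      qed
      moreover have "z \<in> orb `` {z}" using equiv_class_self[OF equiv_orb zA] .
      moreover have "orb `` {z} \<subseteq> B" using invariant_set_orb[OF B] zB by blast
      moreover have "orb `` {z} \<in> tuples n A // orb" using zA by (rule quotientI)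
      moreover have "?N \<subseteq> B" by (auto simp: R_def)
      ultimately have "{X \<in> tuples n A // orb. X \<subseteq> ?N} \<subset> {X \<in> tuples n A // orb. X \<subseteq> B}" by blast
      moreover have "finite {X \<in> tuples n A // orb. X \<subseteq> B}"
        using olig unfolding oligomorphic_def by auto
      ultimately have "card {X \<in> tuples n A // orb. X \<subseteq> ?N} < card {X \<in> tuples n A // orb. X \<subseteq> B}"
        by (simp add: psubset_card_mono)
      then show ?thesis
        using less.hyps[OF _ invariant_set_neighbours[OF R zA] T] by blast
    qed
  qed
qed

end

section \<open>Naked sets from equational triviality\<close>

locale canonical_subclone = core_clone +
  fixes C
  assumes clone_C: "function_clone A C" and CD: "C \<subseteq> D" and canonical: "canonical A n C G"
begin

abbreviation "Orb \<equiv> tuples n A // orb"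

definition orbit_op where "orbit_op k f = quot_op (tuples n A) orb k (pow_op A n k f)"

text \<open>Canonicity is exactly the congruence condition that makes the value independent of the
  representatives.\<close>

lemma orbit_op_eq:
  assumes kf: "(k, f) \<in> C" and c: "c \<in> tuples k Orb" and t: "t \<in> (\<Pi>\<^sub>E i\<in>{..<k}. c i)"
  shows "orbit_op k f c = orb `` {pow_op A n k f t}"
  unfolding orbit_op_def
proof (rule quot_op_eq[OF equiv_orb c _ t])
  fix s t assume s: "s \<in> (\<Pi>\<^sub>E i\<in>{..<k}. c i)" and t: "t \<in> (\<Pi>\<^sub>E i\<in>{..<k}. c i)"
  note rs = quotient_reps_mem[OF equiv_orb c s] and rt = quotient_reps_mem[OF equiv_orb c t]
  have "(s i, t i) \<in> orb" if "i < k" for i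
    using rs(2)[OF that] rt(2)[OF that] eq_equiv_class[OF _ equiv_orb tuples_mem[OF rt(1) that]] by simp
  then show "(pow_op A n k f s, pow_op A n k f t) \<in> orb"
    using canonical kf rs(1) rt(1) unfolding canonical_def invariant_rel_def by blast
qed

lemma orbit_op_classes:
  assumes kf: "(k, f) \<in> C" and t: "t \<in> tuples k (tuples n A)"
  shows "orbit_op k f (\<lambda>i\<in>{..<k}. orb `` {t i}) = orb `` {pow_op A n k f t}"
proof (rule orbit_op_eq[OF kf])
  show "(\<lambda>i\<in>{..<k}. orb `` {t i}) \<in> tuples k Orb"
    using t by (intro tuples_restrict quotientI) (rule tuples_mem)
  show "t \<in> (\<Pi>\<^sub>E i\<in>{..<k}. (\<lambda>i\<in>{..<k}. orb `` {t i}) i)"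
    using t equiv_class_self[OF equiv_orb] by (auto simp: tuples_def PiE_iff)
qed

lemma orbit_op_in:
  assumes kf: "(k, f) \<in> C" and c: "c \<in> tuples k Orb"
  shows "orbit_op k f c \<in> Orb"
proof -
  obtain t where t: "t \<in> (\<Pi>\<^sub>E i\<in>{..<k}. c i)" using quotient_tuple_reps[OF equiv_orb c] .
  show ?thesis
    unfolding orbit_op_eq[OF kf c t]
    using pow_op_in_tuples[OF clone_operations[OF clone_C kf] quotient_reps_mem(1)[OF equiv_orb c t]]
    by (rule quotientI)
qed

lemma orbit_op_extensional: "orbit_op k f \<in> extensional (tuples k Orb)"
  by (simp add: orbit_op_def quot_op_def)

lemma orbit_op_comp:
  assumes kf: "(k, f) \<in> C" and g: "\<And>i. i < k \<Longrightarrow> (m, g i) \<in> C"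
  shows "orbit_op m (comp_op A k m f g) = comp_op Orb k m (orbit_op k f) (\<lambda>i. orbit_op m (g i))"
proof (rule extensionalityI[OF orbit_op_extensional])
  show "comp_op Orb k m (orbit_op k f) (\<lambda>i. orbit_op m (g i)) \<in> extensional (tuples m Orb)"
    by (simp add: comp_op_def)
  fix c assume c: "c \<in> tuples m Orb"
  obtain t where t: "t \<in> (\<Pi>\<^sub>E i\<in>{..<m}. c i)" using quotient_tuple_reps[OF equiv_orb c] .
  have tt: "t \<in> tuples m (tuples n A)" using quotient_reps_mem(1)[OF equiv_orb c t] .
  let ?s = "\<lambda>i\<in>{..<k}. pow_op A n m (g i) t"
  have s: "?s \<in> tuples k (tuples n A)"
    using pow_op_in_tuples[OF clone_operations[OF clone_C g] tt] by (simp add: tuples_restrict)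
  have "orbit_op m (comp_op A k m f g) c = orb `` {pow_op A n k f ?s}"
    using orbit_op_eq[OF clone_comp[OF clone_C kf g] c t] pow_op_comp_op[OF clone_C kf g tt] by simp
  also have "\<dots> = orbit_op k f (\<lambda>i\<in>{..<k}. orb `` {?s i})" using orbit_op_classes[OF kf s] by simp
  also have "(\<lambda>i\<in>{..<k}. orb `` {?s i}) = (\<lambda>i\<in>{..<k}. orbit_op m (g i) c)"
    by (rule restrict_ext) (simp add: orbit_op_eq[OF g c t])
  also have "orbit_op k f \<dots> = comp_op Orb k m (orbit_op k f) (\<lambda>i. orbit_op m (g i)) c"
    using c by (simp add: comp_op_def)
  finally show "orbit_op m (comp_op A k m f g) c = comp_op Orb k m (orbit_op k f) (\<lambda>i. orbit_op m (g i)) c" .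
qed

lemma orbit_op_proj:
  assumes "i < k"
  shows "orbit_op k (proj_op A k i) = proj_op Orb k i"
proof (rule extensionalityI[OF orbit_op_extensional])
  show "proj_op Orb k i \<in> extensional (tuples k Orb)" by (simp add: proj_op_def)
  fix c assume c: "c \<in> tuples k Orb"
  obtain t where t: "t \<in> (\<Pi>\<^sub>E i\<in>{..<k}. c i)" using quotient_tuple_reps[OF equiv_orb c] .
  note r = quotient_reps_mem[OF equiv_orb c t]
  show "orbit_op k (proj_op A k i) c = proj_op Orb k i c"
    using orbit_op_eq[OF clone_proj[OF clone_C assms] c t] pow_op_proj_op[OF assms r(1)] r(2)[OF assms] c
    by (simp add: proj_op_def)
qed

text \<open>The core property enters here: by \<open>orb_pow_op\<close>, an operation applied to a
  constant tuple of representatives does not leave their orbit.\<close>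

lemma orbit_op_idempotent:
  assumes kf: "(k, f) \<in> C" and X: "X \<in> Orb"
  shows "orbit_op k f (\<lambda>i\<in>{..<k}. X) = X"
proof -
  obtain s where s: "s \<in> tuples n A" "X = orb `` {s}" using X by (auto elim: quotientE)
  let ?t = "\<lambda>i\<in>{..<k}. s"
  have t: "?t \<in> tuples k (tuples n A)" using s by (simp add: tuples_restrict)
  have ss: "(s, s) \<in> orb" using equiv_orb s(1) by (auto elim!: equivE dest: refl_onD)
  have "(s, pow_op A n k f ?t) \<in> orb"
    by (rule orb_pow_op[OF _ t s(1)]) (use kf CD ss in auto)
  then have "orb `` {pow_op A n k f ?t} = X" using s(2) equiv_class_eq[OF equiv_orb] by blast
  moreover have "(\<lambda>i\<in>{..<k}. orb `` {?t i}) = (\<lambda>i\<in>{..<k}. X)" by (rule restrict_ext) (simp add: s(2))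
  ultimately show ?thesis using orbit_op_classes[OF kf t] by simp
qed

text \<open>\<open>B\<close> is a subalgebra of a finite power of the algebra of orbits, and its elements are split
  by \<open>\<iota>\<close> into classes on which \<open>C\<close> acts by projections. Since orbits are idempotent,
  fixing a coordinate gives a subalgebra; once no further coordinate can be fixed
  without losing a class, the classes are determined by a single coordinate \<open>p\<close>.\<close>

lemma projective_quotient_from_power:
  assumes \<iota>: "\<And>k f. (k, f) \<in> C \<Longrightarrow> \<iota> k f < k"
    and \<iota>_comp: "\<And>k f m g. (k, f) \<in> C \<Longrightarrow> (\<And>i. i < k \<Longrightarrow> (m, g i) \<in> C) \<Longrightarrow>
      \<iota> m (comp_op A k m f g) = \<iota> m (g (\<iota> k f))"
    and \<iota>_cong: "\<And>k f g. (k, f) \<in> C \<Longrightarrow> (k, g) \<in> C \<Longrightarrow> orbit_op k f = orbit_op k g \<Longrightarrow> \<iota> k f = \<iota> k g"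
  shows "finite J \<Longrightarrow> J \<subseteq> tuples m Orb \<Longrightarrow> (\<And>b. b \<in> B \<Longrightarrow> (m, b) \<in> C) \<Longrightarrow>
    (\<And>k f b. (k, f) \<in> C \<Longrightarrow> (\<And>i. i < k \<Longrightarrow> b i \<in> B) \<Longrightarrow> comp_op A k m f b \<in> B) \<Longrightarrow>
    b1 \<in> B \<Longrightarrow> b2 \<in> B \<Longrightarrow> \<iota> m b1 \<noteq> \<iota> m b2 \<Longrightarrow>
    (\<And>b b' p. b \<in> B \<Longrightarrow> b' \<in> B \<Longrightarrow> p \<in> tuples m Orb - J \<Longrightarrow> orbit_op m b p = orbit_op m b' p) \<Longrightarrow>
    \<exists>S E. projective_quotient A n C G S E"
proof (induction J arbitrary: B b1 b2 rule: finite_induct)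
  case empty
  \<comment> \<open>\<open>J\<close> collects the coordinates where members of \<open>B\<close> may
    still differ. Once it is empty, \<open>b1\<close> and \<open>b2\<close> induce the same
    operation, and \<iota>_cong contradicts their different indices.\<close>
  have "orbit_op m b1 = orbit_op m b2"
    by (rule extensionalityI[OF orbit_op_extensional orbit_op_extensional])
      (use empty.prems(4,5,7) in blast)
  then show ?case using \<iota>_cong empty.prems(2,4,5,6) by blast
next
  case (insert p J)
  note BC = insert.prems(2) and Bcl = insert.prems(3)
  have p: "p \<in> tuples m Orb" using insert.prems(1) by simp
  have comp: "orbit_op m (comp_op A k m f b) p = orbit_op k f (\<lambda>i\<in>{..<k}. orbit_op m (b i) p)"
    if "(k, f) \<in> C" "\<And>i. i < k \<Longrightarrow> b i \<in> B" for k f b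
    using orbit_op_comp[OF that(1), of m b] BC that(2) p by (simp add: comp_op_def)
  show ?case
  proof (cases "\<exists>b\<in>B. \<exists>b'\<in>B. orbit_op m b p = orbit_op m b' p \<and> \<iota> m b \<noteq> \<iota> m b'")
    case True
    then obtain b b' where bb: "b \<in> B" "b' \<in> B" "orbit_op m b p = orbit_op m b' p" "\<iota> m b \<noteq> \<iota> m b'"
      by blast
    let ?X = "orbit_op m b p"
    have X: "?X \<in> Orb" using orbit_op_in[OF BC[OF bb(1)] p] .
    let ?B = "{d \<in> B. orbit_op m d p = ?X}"
    show ?thesis
    proof (rule insert.IH[of ?B b b'])
      fix k f d assume kf: "(k, f) \<in> C" and d: "\<And>i. i < k \<Longrightarrow> d i \<in> ?B"
      have "(\<lambda>i\<in>{..<k}. orbit_op m (d i) p) = (\<lambda>i\<in>{..<k}. ?X)" by (rule restrict_ext) (use d in simp)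
      then have "orbit_op m (comp_op A k m f d) p = ?X"
        using comp[OF kf, of d] d orbit_op_idempotent[OF kf X] by simp
      then show "comp_op A k m f d \<in> ?B" using Bcl[OF kf, of d] d by simp
    next
      fix d d' q assume "d \<in> ?B" "d' \<in> ?B" "q \<in> tuples m Orb - J"
      then show "orbit_op m d q = orbit_op m d' q"
        using insert.prems(7)[of d d' q] by (cases "q = p") auto
    qed (use insert.prems(1) BC bb in auto)
  next
    case False
    \<comment> \<open>In this case the value at \<open>p\<close> determines the index.
      \<open>S\<close> is the union of the orbits taken as values at \<open>p\<close> by members of
      \<open>B\<close>, and \<open>E\<close> compares the indices of the members taking
      them.\<close>
    define S where "S = {s \<in> tuples n A. \<exists>b\<in>B. orb `` {s} = orbit_op m b p}"
    define E where "E = {(s, t). s \<in> tuples n A \<and> t \<in> tuples n A \<and>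
      (\<exists>b\<in>B. \<exists>b'\<in>B. \<iota> m b = \<iota> m b' \<and> orb `` {s} = orbit_op m b p \<and> orb `` {t} = orbit_op m b' p)}"
    have ES: "E \<subseteq> S \<times> S" by (auto simp: S_def E_def)
    have E_iff: "(s, t) \<in> E \<longleftrightarrow> \<iota> m b = \<iota> m b'"
      if "s \<in> tuples n A" "t \<in> tuples n A" "b \<in> B" "b' \<in> B" "orb `` {s} = orbit_op m b p"
        "orb `` {t} = orbit_op m b' p" for s t b b'
    proof
      assume "(s, t) \<in> E"
      then obtain c c' where c: "c \<in> B" "c' \<in> B" "\<iota> m c = \<iota> m c'" "orb `` {s} = orbit_op m c p"
        "orb `` {t} = orbit_op m c' p" by (auto simp: E_def)
      have "\<iota> m c = \<iota> m b" using False c(1,4) that(3,5) by metis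
      moreover have "\<iota> m c' = \<iota> m b'" using False c(2,5) that(4,6) by metis
      ultimately show "\<iota> m b = \<iota> m b'" using c(3) by simp
    qed (use that in \<open>auto simp: E_def\<close>)
    have eq: "equiv S E"
    proof (rule equivI[OF ES])
      show "refl_on S E" by (rule refl_onI) (auto simp: S_def E_def)
      show "sym E"
      proof (rule symI)
        fix s t assume "(s, t) \<in> E"
        then obtain b c where "s \<in> tuples n A" "t \<in> tuples n A" "b \<in> B" "c \<in> B" "\<iota> m b = \<iota> m c"
          "orb `` {s} = orbit_op m b p" "orb `` {t} = orbit_op m c p" by (auto simp: E_def)
        then show "(t, s) \<in> E" using E_iff[of t s c b] by simp
      qed
      show "trans E"
      proof (rule transI)
        fix r s t assume rs: "(r, s) \<in> E" and st: "(s, t) \<in> E"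
        then obtain b c d where *: "r \<in> tuples n A" "s \<in> tuples n A" "t \<in> tuples n A"
          "b \<in> B" "c \<in> B" "d \<in> B" "orb `` {r} = orbit_op m b p" "orb `` {s} = orbit_op m c p"
          "orb `` {t} = orbit_op m d p" by (auto simp: E_def)
        then have "\<iota> m b = \<iota> m c" "\<iota> m c = \<iota> m d"
          using rs st E_iff[of r s b c] E_iff[of s t c d] by auto
        then show "(r, t) \<in> E" using * E_iff[of r t b d] by simp
      qed
    qed
    have rep: "\<exists>s\<in>tuples n A. orb `` {s} = orbit_op m b p" if "b \<in> B" for b
      using orbit_op_in[OF BC[OF that] p] by (metis quotientE)
    obtain s1 s2 where s12: "s1 \<in> tuples n A" "s2 \<in> tuples n A" "orb `` {s1} = orbit_op m b1 p"
      "orb `` {s2} = orbit_op m b2 p" using rep[OF insert.prems(4)] rep[OF insert.prems(5)] by auto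
    have ne: "s1 \<in> S" "s2 \<in> S" "(s1, s2) \<notin> E"
      using s12 insert.prems(4,5,6) E_iff[of s1 s2 b1 b2] by (auto simp: S_def)
    \<comment> \<open>If \<open>b i\<close> takes the orbit of \<open>t i\<close> at
      \<open>p\<close>, then the composite of \<open>f\<close> with the \<open>b i\<close> takes the
      orbit of the value of \<open>f\<close> at \<open>t\<close>. By \<iota>_comp its index is that
      of \<open>b (\<iota> k f)\<close>.\<close>
    have pr: "(t (\<iota> k f), pow_op A n k f t) \<in> E" if kf: "(k, f) \<in> C" and t: "t \<in> tuples k S" for k f t
    proof -
      have tt: "t \<in> tuples k (tuples n A)" using t tuples_mono[of S "tuples n A" k] by (auto simp: S_def)
      have "\<forall>i. \<exists>b. i < k \<longrightarrow> b \<in> B \<and> orb `` {t i} = orbit_op m b p"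
        using tuples_mem[OF t] unfolding S_def by blast
      then obtain b where b: "\<And>i. i < k \<Longrightarrow> b i \<in> B" "\<And>i. i < k \<Longrightarrow> orb `` {t i} = orbit_op m (b i) p"
        by metis
      have "(\<lambda>i\<in>{..<k}. orb `` {t i}) = (\<lambda>i\<in>{..<k}. orbit_op m (b i) p)"
        by (rule restrict_ext) (simp add: b(2))
      then have "orb `` {pow_op A n k f t} = orbit_op m (comp_op A k m f b) p"
        using orbit_op_classes[OF kf tt] comp[OF kf b(1)] by simp
      then show ?thesis
        using E_iff[of "t (\<iota> k f)" "pow_op A n k f t" "b (\<iota> k f)" "comp_op A k m f b"]
          tuples_mem[OF tt \<iota>[OF kf]] pow_op_in_tuples[OF clone_operations[OF clone_C kf] tt]
          b \<iota>[OF kf] Bcl[OF kf b(1)] \<iota>_comp[OF kf BC[OF b(1)]] by simp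
    qed
    have gr: "(x, act n g x) \<in> E" if "x \<in> S" "g \<in> G" for x g
    proof -
      have x: "x \<in> tuples n A" using that by (simp add: S_def)
      have "orb `` {x} = orb `` {act n g x}"
        using equiv_class_eq[OF equiv_orb orb_act[OF that(2) x]] .
      then show ?thesis using that act_in_tuples[OF that(2) x] by (auto simp: S_def E_def)
    qed
    have "projective_quotient A n C G S E"
      unfolding projective_quotient_def
    proof (intro conjI)
      show "S \<subseteq> tuples n A" by (auto simp: S_def)
      show "\<forall>(k, f)\<in>C. \<exists>i<k. \<forall>t\<in>tuples k S. (t i, pow_op A n k f t) \<in> E"
        using pr \<iota> by blast
    qed (use eq ne gr in auto)
    then show ?thesis by blast
  qed
qed

text \<open>The index of an operation is read off from the homomorphic image of its induced
  operation. Binary operations suffice for a nontrivial splitting because the two binary projections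
  have different indices.\<close>

lemma projective_quotient_exists:
  assumes fin: "finite Orb" and triv: "equationally_trivial Orb (orbit_clone A n C G)"
  shows "\<exists>S E. projective_quotient A n C G S E"
proof -
  obtain h where h: "clone_hom Orb (orbit_clone A n C G) {0, 1::nat} (proj_clone {0, 1}) h"
    using triv unfolding equationally_trivial_def by blast
  have mem: "(k, orbit_op k f) \<in> orbit_clone A n C G" if "(k, f) \<in> C" for k f
    using that unfolding orbit_clone_def orbit_op_def by blast
  have "\<exists>i<k. h k (orbit_op k f) = proj_op {0, 1} k i" if "(k, f) \<in> C" for k f
  proof -
    have "(k, h k (orbit_op k f)) \<in> proj_clone {0, 1}"
      using h mem[OF that] unfolding clone_hom_def by blast
    then show ?thesis by (auto simp: proj_clone_def)
  qed
  then have "\<exists>\<iota>. \<forall>k f. (k, f) \<in> C \<longrightarrow> \<iota> k f < k \<and> h k (orbit_op k f) = proj_op {0, 1} k (\<iota> k f)"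
    by metis
  then obtain \<iota> where \<iota>: "\<And>k f. (k, f) \<in> C \<Longrightarrow> \<iota> k f < k"
      "\<And>k f. (k, f) \<in> C \<Longrightarrow> h k (orbit_op k f) = proj_op {0, 1} k (\<iota> k f)" by blast
  \<comment> \<open>Passing to orbits commutes with composition and so does \<open>h\<close>; on the
    two-element set \<open>comp_op_proj_op\<close> computes the composite and
    \<open>proj_op_inj\<close> recovers its index.\<close>
  have \<iota>_comp: "\<iota> m (comp_op A k m f g) = \<iota> m (g (\<iota> k f))"
    if kf: "(k, f) \<in> C" and g: "\<And>i. i < k \<Longrightarrow> (m, g i) \<in> C" for k f m g
  proof (rule proj_op_inj)
    have "proj_op {0, 1} m (\<iota> m (comp_op A k m f g)) = h m (orbit_op m (comp_op A k m f g))"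
      using \<iota>(2)[OF clone_comp[OF clone_C kf g]] by simp
    also have "orbit_op m (comp_op A k m f g) = comp_op Orb k m (orbit_op k f) (\<lambda>i. orbit_op m (g i))"
      by (rule orbit_op_comp[OF kf]) (rule g)
    also have "h m \<dots> = comp_op {0, 1} k m (h k (orbit_op k f)) (\<lambda>i. h m (orbit_op m (g i)))"
      by (rule clone_hom_comp[OF h mem[OF kf]]) (rule mem[OF g])
    also have "\<dots> = proj_op {0, 1} m (\<iota> m (g (\<iota> k f)))"
      unfolding \<iota>(2)[OF kf] using \<iota> g kf by (intro comp_op_proj_op) auto
    finally show "proj_op {0, 1::nat} m (\<iota> m (comp_op A k m f g)) = proj_op {0, 1} m (\<iota> m (g (\<iota> k f)))" .
  qed (use \<iota>(1) clone_comp[OF clone_C kf g] g kf in auto)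
  have \<iota>_cong: "\<iota> k f = \<iota> k g" if "(k, f) \<in> C" "(k, g) \<in> C" "orbit_op k f = orbit_op k g" for k f g
    by (rule proj_op_inj[of k]) (use \<iota>(2)[OF that(1)] \<iota>(2)[OF that(2)] \<iota>(1) that in auto)
  have \<iota>_proj: "\<iota> 2 (proj_op A 2 i) = i" if "i < 2" for i
  proof (rule proj_op_inj[of 2])
    have "h 2 (proj_op Orb 2 i) = proj_op {0, 1} 2 i" using clone_hom_proj[OF h that] .
    then show "proj_op {0, 1::nat} 2 (\<iota> 2 (proj_op A 2 i)) = proj_op {0, 1} 2 i"
      using \<iota>(2)[OF clone_proj[OF clone_C that]] orbit_op_proj[OF that] by simp
  qed (use \<iota>(1)[OF clone_proj[OF clone_C that]] that in auto)
  \<comment> \<open>Start with all binary operations of \<open>C\<close> and with \<open>J\<close>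
    the full coordinate set, so that agreement outside \<open>J\<close> holds vacuously.\<close>
  show ?thesis
  proof (rule projective_quotient_from_power[where \<iota> = \<iota> and m = 2 and B = "{b. (2, b) \<in> C}"
        and ?b1.0 = "proj_op A 2 0" and ?b2.0 = "proj_op A 2 1" and J = "tuples 2 Orb"])
    show "finite (tuples 2 Orb)" by (rule finite_tuples[OF fin])
    show "\<iota> 2 (proj_op A 2 0) \<noteq> \<iota> 2 (proj_op A 2 1)" using \<iota>_proj by simp
    show "\<iota> k f < k" if "(k, f) \<in> C" for k f using \<iota>(1)[OF that] .
    show "\<iota> m (comp_op A k m f g) = \<iota> m (g (\<iota> k f))"
      if "(k, f) \<in> C" "\<And>i. i < k \<Longrightarrow> (m, g i) \<in> C" for k f m g
      using that by (rule \<iota>_comp)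
    show "\<iota> k f = \<iota> k g" if "(k, f) \<in> C" "(k, g) \<in> C" "orbit_op k f = orbit_op k g" for k f g
      using that by (rule \<iota>_cong)
    show "comp_op A k 2 f b \<in> {b. (2, b) \<in> C}"
      if "(k, f) \<in> C" "\<And>i. i < k \<Longrightarrow> b i \<in> {b. (2, b) \<in> C}" for k f b
      using clone_comp[OF clone_C that(1), of 2 b] that(2) by simp
  qed (use clone_proj[OF clone_C, of _ 2] in auto)
qed

end

theorem theorem3p7:
  fixes A :: "'a set" and n :: nat and C D :: "'a opset"
  assumes "n \<ge> 1"
    and "function_clone A C" and "function_clone A D" and "C \<subseteq> D"
    and "oligomorphic A C" and "oligomorphic A D"
    and "model_complete_core A D" and "without_algebraicity A D"
    and "canonical A n C (clone_group A D)"
    and "equationally_trivial (tuples n A // orbit_rel A (clone_group A D) n)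
           (orbit_clone A n C (clone_group A D))"
  shows "\<exists>S E. naked_set A n C S E \<and> invariant_classes n (clone_group A D) S E \<and>
    ((\<exists>S' \<eta>. approximates A n S' \<eta> S E \<and> invariant_rel A n D \<eta> \<and>
        presmooth A n (clone_group A D) S' \<eta> S E) \<or>
     (\<forall>R. R \<subseteq> tuples n A \<times> tuples n A \<and> invariant_rel A n D R \<and> sym R \<and>
        (\<exists>a\<in>S. \<exists>b\<in>S. disjoint_tuples n a b \<and> (a, b) \<notin> E \<and> (a, b) \<in> R) \<longrightarrow>
        (\<exists>c c'. (c, c') \<in> R \<and> (c, c') \<in> orbit_rel A (clone_group A D) n)))"
proof -
  interpret canonical_subclone A D n C
    using assms by unfold_locales auto
  have "finite Orb" using assms(6) unfolding oligomorphic_def by blast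
  then obtain S E where pq: "projective_quotient A n C G S E"
    using projective_quotient_exists assms(10) by blast
  \<comment> \<open>The descent starts from the set of all tuples.\<close>
  have "invariant_set A n D (tuples n A)"
    unfolding invariant_set_def using pow_op_in_tuples[OF clone_operations[OF clone]] by blast
  from naked_set_dichotomy[OF assms(6,8,4) this pq projective_quotientD(1)[OF pq]]
  obtain S E where "projective_quotient A n C G S E"
    and *: "(\<exists>S' \<eta>. approximates A n S' \<eta> S E \<and> invariant_rel A n D \<eta> \<and> presmooth A n G S' \<eta> S E) \<or>
     (\<forall>R. R \<subseteq> tuples n A \<times> tuples n A \<and> invariant_rel A n D R \<and> sym R \<and>
        (\<exists>a\<in>S. \<exists>b\<in>S. disjoint_tuples n a b \<and> (a, b) \<notin> E \<and> (a, b) \<in> R) \<longrightarrow>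
        (\<exists>c c'. (c, c') \<in> R \<and> (c, c') \<in> orb))"
    by (elim exE conjE)
  then have "naked_set A n C S E" "invariant_classes n G S E"
    by (simp_all add: projective_quotient_naked_set projective_quotient_invariant_classes)
  then show ?thesis using * by (intro exI[of _ S] exI[of _ E] conjI)
qed

end
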